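(* Let $X(t),t\in\mathbb{Z}^d$, be a stationary max-stable rf with unit Fréchet marginals, spectral rf $Z$, spectral tail rf $\Theta$, and $Y=R\Theta$. Let $\mathcal I$ be an anchoring map with $P(\mathcal I(Y)\in\mathbb{Z}^d,\mathcal S(Y)<\infty)=P(\mathcal S(Y)<\infty)$. If $P(\mathcal S(\Theta)<\infty)>0$, then $$\theta_X=P(\mathcal I(Y)=0,\mathcal S(Y)<\infty)=P(\mathcal I_{fe}(Y)=0)=P(\mathcal I_A(\Theta)=0)=E\Big[\frac{\max_t\Theta(t)}{\sum_t\Theta(t)}\Big]=E\Big[Z(0)\frac{\max_tZ(t)}{\sum_tZ(t)}\Big]=E\Big[\frac1{\mathcal B(Y)}\Big],$$ and if moreover $\mathcal I$ is $0$-homogeneous then also $\theta_X=P(\mathcal I(\Theta)=0,\mathcal S(\Theta)<\infty)$. Furthermore, $\{\mathcal B(Y)<\infty\}=\{\mathcal S(Y)<\infty\}$ almost surely, and $\theta_X=1$ if and only if $\Theta(i)=0$ almost surely for every $i\in\mathbb{Z}^d\setminus\{0\}$. (The identity $\theta_X=E[1/\mathcal B(Y)]$ holds also without the assumption $P(\mathcal S(\Theta)<\infty)>0$.)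
   Context: $E=[0,\infty)^{\mathbb{Z}^d}$ with product $\sigma$-field; shift $(B^hf)(t)=f(t-h)$; $\mathcal S(f)=\sum_{t}f(t)$, $\mathcal B(f)=\sum_t\mathbf 1(f(t)>1)$; ratios $0/0$ and $\infty/\infty$ (and $c/\infty$) are interpreted as $0$, and $1/\infty=0$. A max-stable rf $X$ with unit Fréchet marginals has a spectral rf $Z$: non-negative, $E Z(t)=1$, $P(\sup_tZ(t)>0)=1$, with $-\ln P(X(t_i)\le x_i,i\le n)=E[\max_{i\le n}Z(t_i)/x_i]$. Its spectral tail rf $\Theta$ is given by $P(\Theta\in A)=E[Z(0)\mathbf 1(Z/Z(0)\in A)]$ ($\Theta(0)=1$ a.s.); $Y=R\Theta$ with $R$ unit Pareto ($P(R>x)=1/x$, $x\ge1$) independent of $\Theta$. Extremal index: $\theta_X=\lim_n n^{-d}E[\max_{t\in[0,n]^d\cap\mathbb{Z}^d}Z(t)]\in[0,1]$. Fix a translation-invariant total order on $\mathbb{Z}^d$ (minima below are with respect to it). An anchoring map is a measurable $\mathcal I:E\to\mathbb{Z}^d\cup\{\infty\}$ such that for all $f$ with $\mathcal I(f)\in\mathbb{Z}^d$ and all $i$: (i) $\mathcal I(f)=i$ implies $f(i)\ge\min(f(0),1)$; (ii) $\mathcal I(f)=\mathcal I(B^if)-i$. First maximum functional: $\mathcal I_A(f)=\min\{j:f(j)=\max_if(i)\}$ if $\mathcal S(f)<\infty$ and $\max_if(i)>0$, and $\mathcal I_A(f)=\infty$ otherwise. First exceedance functional: $\mathcal I_{fe}(f)=\min\{j:f(j)>1\}$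 if $\mathcal S(f)<\infty$ and $\max_if(i)>1$, and $\infty$ otherwise. $\mathcal I$ is 0-homogeneous if $\mathcal I(cf)=\mathcal I(f)$ for $c>0$. *)

theory Defs
  imports "HOL-Probability.Probability"
begin

text \<open>Random fields indexed by the lattice int^d are modelled as functions of type
  int^'d => real; the dimension d is CARD('d).\<close>

type_synonym 'd field = "int ^ 'd \<Rightarrow> real"

definition PE :: "'d::finite field measure" where
  "PE = Pi\<^sub>M UNIV (\<lambda>_. borel)"

definition shift :: "int ^ 'd \<Rightarrow> 'd::finite field \<Rightarrow> 'd field" where
  "shift h f = (\<lambda>t. f (t - h))"

definition Ssum :: "'d::finite field \<Rightarrow> ennreal" where
  "Ssum f = (\<Sum>\<^sub>\<infinity>t. ennreal (f t))"

text \<open>sup_t f(t) in [0,infinity] (a maximum whenever S(f) is finite).\<close>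
definition Mx :: "'d::finite field \<Rightarrow> ennreal" where
  "Mx f = (\<Squnion>t. ennreal (f t))"

definition Bcnt :: "'d::finite field \<Rightarrow> ennreal" where
  "Bcnt f = (if finite {t. f t > 1} then of_nat (card {t. f t > 1}) else \<top>)"

text \<open>Ratio with the conventions 0/0 = 0, c/infinity = 0 (in particular infinity/infinity = 0).\<close>
definition ratio_enn :: "ennreal \<Rightarrow> ennreal \<Rightarrow> real" where
  "ratio_enn a b = (if b = 0 \<or> b = \<top> then 0 else enn2real a / enn2real b)"

definition transl_inv_total_order :: "((int ^ 'd::finite) \<times> (int ^ 'd)) set \<Rightarrow> bool" where
  "transl_inv_total_order r \<longleftrightarrow> linear_order r \<and>
     (\<forall>i j h. (i, j) \<in> r \<longleftrightarrow> (i + h, j + h) \<in> r)"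

definition ord_min :: "((int ^ 'd::finite) \<times> (int ^ 'd)) set \<Rightarrow> (int ^ 'd) set \<Rightarrow> int ^ 'd" where
  "ord_min r A = (THE j. j \<in> A \<and> (\<forall>i\<in>A. (j, i) \<in> r))"

text \<open>Anchoring maps; None plays the role of the point infinity.\<close>
definition anchoring_map :: "('d::finite field \<Rightarrow> (int ^ 'd) option) \<Rightarrow> bool" where
  "anchoring_map I \<longleftrightarrow> I \<in> measurable PE (count_space UNIV) \<and>
     (\<forall>f j i. (\<forall>t. 0 \<le> f t) \<longrightarrow> I f = Some j \<longrightarrow>
        f j \<ge> min (f 0) 1 \<and> I (shift i f) = Some (j + i))"

definition zero_homogeneous :: "('d::finite field \<Rightarrow> (int ^ 'd) option) \<Rightarrow> bool" where
  "zero_homogeneous I \<longleftrightarrow> (\<forall>f (c::real). (\<forall>t. 0 \<le> f t) \<longrightarrow> c > 0 \<longrightarrow> I (\<lambda>t. c * f t) = I f)"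

definition IA :: "((int ^ 'd::finite) \<times> (int ^ 'd)) set \<Rightarrow> 'd field \<Rightarrow> (int ^ 'd) option" where
  "IA r f = (if Ssum f < \<top> \<and> (\<exists>t. f t > 0)
             then Some (ord_min r {j. \<forall>i. f i \<le> f j}) else None)"

definition Ife :: "((int ^ 'd::finite) \<times> (int ^ 'd)) set \<Rightarrow> 'd field \<Rightarrow> (int ^ 'd) option" where
  "Ife r f = (if Ssum f < \<top> \<and> (\<exists>t. f t > 1)
              then Some (ord_min r {j. f j > 1}) else None)"

definition stationary :: "'a measure \<Rightarrow> ('a \<Rightarrow> 'd::finite field) \<Rightarrow> bool" where
  "stationary M X \<longleftrightarrow> X \<in> measurable M PE \<and>
     (\<forall>h. distr M PE (\<lambda>\<omega>. shift h (X \<omega>)) = distr M PE X)"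

definition spectral_rf :: "'a measure \<Rightarrow> ('a \<Rightarrow> 'd::finite field) \<Rightarrow> ('a \<Rightarrow> 'd field) \<Rightarrow> bool" where
  "spectral_rf M X Z \<longleftrightarrow>
     X \<in> measurable M PE \<and> Z \<in> measurable M PE \<and>
     (\<forall>\<omega>\<in>space M. \<forall>t. 0 \<le> Z \<omega> t) \<and>
     (\<forall>t. integrable M (\<lambda>\<omega>. Z \<omega> t) \<and> (\<integral>\<omega>. Z \<omega> t \<partial>M) = 1) \<and>
     (AE \<omega> in M. \<exists>t. 0 < Z \<omega> t) \<and>
     (\<forall>T x. finite T \<longrightarrow> T \<noteq> {} \<longrightarrow> (\<forall>t\<in>T. 0 < x t) \<longrightarrow>
        measure M {\<omega>\<in>space M. \<forall>t\<in>T. X \<omega> t \<le> x t}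
          = exp (- (\<integral>\<omega>. Max ((\<lambda>t. Z \<omega> t / x t) ` T) \<partial>M)))"

definition spectral_tail :: "'a measure \<Rightarrow> ('a \<Rightarrow> 'd::finite field) \<Rightarrow> ('a \<Rightarrow> 'd field) \<Rightarrow> bool" where
  "spectral_tail M Z Th \<longleftrightarrow> Th \<in> measurable M PE \<and>
     (\<forall>A\<in>sets PE. measure M {\<omega>\<in>space M. Th \<omega> \<in> A}
        = (\<integral>\<omega>. Z \<omega> 0 * indicator A (\<lambda>t. Z \<omega> t / Z \<omega> 0) \<partial>M))"

definition unit_pareto :: "'a measure \<Rightarrow> ('a \<Rightarrow> real) \<Rightarrow> bool" where
  "unit_pareto M R \<longleftrightarrow> R \<in> borel_measurable M \<and>
     (\<forall>x\<ge>1. measure M {\<omega>\<in>space M. R \<omega> > x} = 1 / x)"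

definition cube :: "nat \<Rightarrow> (int ^ 'd::finite) set" where
  "cube n = {t. \<forall>i. 0 \<le> t $ i \<and> t $ i \<le> int n}"

text \<open>The sequence n^{-d} E[max_{t in [0,n]^d} Z(t)] whose limit is the extremal index.\<close>
definition ext_seq :: "'a measure \<Rightarrow> ('a \<Rightarrow> 'd::finite field) \<Rightarrow> nat \<Rightarrow> real" where
  "ext_seq M Z n = (\<integral>\<omega>. Max ((\<lambda>t. Z \<omega> t) ` cube n) \<partial>M) / real n ^ CARD('d)"

end

theory Submission
  imports Defs
begin

text \<open>
  Let \<open>\<nu>\<close> be the image of \<open>P \<otimes> z\<^sup>-\<^sup>2 dz\<close> under \<open>(\<omega>, z) \<mapsto> z Z(\<omega>)\<close>. The sets on which some
  coordinate of a finite family exceeds a positive level have \<open>\<nu>\<close>-measure \<open>E max Z(t)/x(t)\<close>, so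
  stationarity of \<open>X\<close> makes \<open>\<nu>\<close> shift invariant, and \<open>Y\<close> has law \<open>\<nu>\<close> restricted to \<open>f(0) > 1\<close>.

  Spreading unit mass evenly over the exceedances in \<open>[0,n]\<^sup>d\<close> writes \<open>E max Z\<close> over the cube as a sum of
  terms \<open>E[1 / #{s \<in> [0,n]\<^sup>d - t : Y(s) > 1}]\<close>, whose averages converge to \<open>E[1/B(Y)]\<close>.

  Shift invariance also gives the mass transport identity
  \<open>\<integral> w(f) \<Sum>\<^sub>t v(B\<^sup>t f) d\<nu> = \<integral> v(f) \<Sum>\<^sub>t w(B\<^sup>t f) d\<nu>\<close>. Hence all weights \<open>w\<close> that sum to the indicator of
  \<open>S < \<infinity>, max > 1\<close> along every orbit have the same integral. Anchoring maps,
  \<open>1(f(0) > 1)/B(f)\<close> and \<open>f(0)/S(f) 1(max f > 1)\<close> are such weights; integrating the last one over \<open>z\<close>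
  produces \<open>E[Z(0) max Z/\<Sum> Z]\<close>. The same identity with \<open>v(f) = f(0)\<close> shows that \<open>B < \<infinity>\<close> forces \<open>S < \<infinity>\<close>.
\<close>

section \<open>Functionals of fields\<close>

text \<open>The measure \<open>\<nu>\<close> has infinite total mass, so standard probability
  arguments need substitutes. Invariance is checked on sets where a positive level is exceeded: they
  have finite mass and exhaust the nonzero fields. Exchanging a lattice sum with an integral rests
  on countability of the lattice alone. \<open>Z\<close> itself need not be stationary; the masses
  in question are functions of the law of \<open>X\<close>, and this is where stationarity enters.

  Two boundary effects shape the statements. An anchor is only known to satisfy f(j) \<ge> 1,
  whereas the law of \<open>Y\<close> sees f(0) > 1, so level 1 must be shown to carry no mass.
  Moreover the integral of f(0) over {max f > 1} diverges logarithmically at large scales, so B and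
  S are compared on {max f \<le> c}, and c is released at the end.

  The expectation of 1/B(Y), named \<open>theta\<close>, is the reference value: the cube averages
  converge to it, and all orbit weights are compared with it.\<close>

lemma finite_to_nat_less: "finite {t::'b::countable. to_nat t < n}"
  by (rule finite_imageD[of to_nat]) (auto intro: finite_subset[of _ "{..<n}"] inj_on_subset[OF inj_to_nat])

text \<open>Initial segments of the enumeration \<open>to_nat\<close> exhaust the index set, so
  monotone convergence applies. A sequence of finite sums, unlike the net of all finite subsets,
  gives measurability in a parameter at once.\<close>

lemma nn_integral_count_space_eq_SUP:
  fixes g :: "'b::countable \<Rightarrow> ennreal"
  shows "(\<integral>\<^sup>+t. g t \<partial>count_space UNIV) = (\<Squnion>n. \<Sum>t | to_nat t < n. g t)"
proof -
  have "(\<integral>\<^sup>+t. g t \<partial>count_space UNIV)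
      = (\<integral>\<^sup>+t. (\<Squnion>n. g t * indicator {t. to_nat t < n} t) \<partial>count_space UNIV)"
  proof (intro nn_integral_cong antisym)
    fix t
    show "g t \<le> (\<Squnion>n. g t * indicator {t. to_nat t < n} t)"
      by (rule SUP_upper2[of "Suc (to_nat t)"]) auto
    show "(\<Squnion>n. g t * indicator {t. to_nat t < n} t) \<le> g t"
      by (rule SUP_least) (auto simp: indicator_def)
  qed
  also have "\<dots> = (\<Squnion>n. \<integral>\<^sup>+t. g t * indicator {t. to_nat t < n} t \<partial>count_space UNIV)"
    by (rule nn_integral_monotone_convergence_SUP)
       (auto simp: incseq_def le_fun_def indicator_def)
  also have "\<dots> = (\<Squnion>n. \<Sum>t | to_nat t < n. g t)"
    by (simp add: nn_integral_count_space_indicator[symmetric] nn_integral_count_space_finite finite_to_nat_less)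
  finally show ?thesis .
qed

lemma infsum_eq_nn_integral_count_space:
  fixes g :: "'b::countable \<Rightarrow> ennreal"
  shows "(\<Sum>\<^sub>\<infinity>t. g t) = (\<integral>\<^sup>+t. g t \<partial>count_space UNIV)"
proof -
  have "(\<Sum>\<^sub>\<infinity>t. g t) = (\<Squnion>F\<in>{F. finite F \<and> F \<subseteq> UNIV}. sum g F)"
    by (rule nonneg_infsum_complete) auto
  also have "\<dots> = (\<integral>\<^sup>+t. g t \<partial>count_space UNIV)"
  proof (intro antisym SUP_least)
    fix F :: "'b set" assume "F \<in> {F. finite F \<and> F \<subseteq> UNIV}"
    then have "sum g F = (\<integral>\<^sup>+t. g t * indicator F t \<partial>count_space UNIV)"
      by (simp add: nn_integral_count_space_indicator[symmetric] nn_integral_count_space_finite)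
    also have "\<dots> \<le> (\<integral>\<^sup>+t. g t \<partial>count_space UNIV)"
      by (intro nn_integral_mono) (auto simp: indicator_def)
    finally show "sum g F \<le> (\<integral>\<^sup>+t. g t \<partial>count_space UNIV)" .
  next
    show "(\<integral>\<^sup>+t. g t \<partial>count_space UNIV) \<le> (\<Squnion>F\<in>{F. finite F \<and> F \<subseteq> UNIV}. sum g F)"
      unfolding nn_integral_count_space_eq_SUP
      by (rule SUP_least) (auto intro!: SUP_upper2 finite_to_nat_less)
  qed
  finally show ?thesis .
qed

lemma borel_measurable_nn_integral_count_space:
  fixes g :: "'b::countable \<Rightarrow> 'c \<Rightarrow> ennreal"
  assumes [measurable]: "\<And>t. g t \<in> borel_measurable N"
  shows "(\<lambda>f. \<integral>\<^sup>+t. g t f \<partial>count_space UNIV) \<in> borel_measurable N"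
  unfolding nn_integral_count_space_eq_SUP by measurable

lemma nn_integral_count_space_translate:
  fixes g :: "int ^ 'd::finite \<Rightarrow> ennreal"
  shows "(\<integral>\<^sup>+t. g (t - h) \<partial>count_space UNIV) = (\<integral>\<^sup>+t. g t \<partial>count_space UNIV)"
  by (rule nn_integral_bij_count_space)
     (auto intro!: bij_betwI[where g = "\<lambda>t. t + h"])

lemma nn_integral_count_space_uminus:
  fixes g :: "int ^ 'd::finite \<Rightarrow> ennreal"
  shows "(\<integral>\<^sup>+t. g (- t) \<partial>count_space UNIV) = (\<integral>\<^sup>+t. g t \<partial>count_space UNIV)"
  by (rule nn_integral_bij_count_space)
     (auto intro!: bij_betwI[where g = "uminus"])

section \<open>Measurability and shift invariance of the functionals\<close>

lemma space_PE [simp]: "space (PE :: 'd::finite field measure) = UNIV"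
  by (simp add: PE_def space_PiM)

lemma measurable_PE_coord [measurable (raw)]: "(\<lambda>f. f t) \<in> borel_measurable (PE :: 'd::finite field measure)"
  unfolding PE_def by measurable

lemma measurable_into_PE:
  fixes g :: "'a \<Rightarrow> 'd::finite field"
  assumes "\<And>t. (\<lambda>\<omega>. g \<omega> t) \<in> borel_measurable N"
  shows "g \<in> measurable N PE"
  unfolding PE_def by (rule measurable_PiM_single') (use assms in auto)

lemma measurable_field_coord:
  "g \<in> measurable N (PE :: 'd::finite field measure) \<Longrightarrow> (\<lambda>\<omega>. g \<omega> t) \<in> borel_measurable N"
  by (rule measurable_compose[OF _ measurable_PE_coord])

lemma measurable_shift [measurable]: "shift h \<in> measurable PE (PE :: 'd::finite field measure)"
  by (rule measurable_into_PE) (simp add: shift_def)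

lemma shift_shift [simp]: "shift h (shift k f) = shift (h + k) f"
  by (auto simp: shift_def fun_eq_iff algebra_simps)

lemma shift_0 [simp]: "shift 0 f = f"
  by (simp add: shift_def)

lemma shift_nonneg: "\<forall>t. 0 \<le> f t \<Longrightarrow> \<forall>t. 0 \<le> shift h f t"
  by (simp add: shift_def)

lemma shift_at_0 [simp]: "shift t f 0 = f (- t)"
  by (simp add: shift_def)

lemma Ssum_eq_nn_integral: "Ssum f = (\<integral>\<^sup>+t. ennreal (f t) \<partial>count_space UNIV)"
  by (simp add: Ssum_def infsum_eq_nn_integral_count_space)

lemma Bcnt_eq_emeasure: "Bcnt f = emeasure (count_space UNIV) {t. f t > 1}"
  by (simp add: Bcnt_def)

lemma Bcnt_eq_nn_integral: "Bcnt f = (\<integral>\<^sup>+t. indicator {1<..} (f t) \<partial>count_space UNIV)"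
proof -
  have "(\<integral>\<^sup>+t. indicator {1<..} (f t) \<partial>count_space UNIV)
      = (\<integral>\<^sup>+t. indicator {t. f t > 1} t \<partial>count_space UNIV)"
    by (intro nn_integral_cong) (auto simp: indicator_def)
  then show ?thesis by (simp add: Bcnt_eq_emeasure)
qed

lemma measurable_Ssum [measurable]: "Ssum \<in> borel_measurable (PE :: 'd::finite field measure)"
  unfolding Ssum_eq_nn_integral[abs_def] by (rule borel_measurable_nn_integral_count_space) measurable

lemma measurable_Bcnt [measurable]: "Bcnt \<in> borel_measurable (PE :: 'd::finite field measure)"
  unfolding Bcnt_eq_nn_integral[abs_def] by (rule borel_measurable_nn_integral_count_space) measurable

lemma measurable_Mx [measurable]: "Mx \<in> borel_measurable (PE :: 'd::finite field measure)"
  unfolding Mx_def[abs_def] by (rule borel_measurable_SUP) auto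

lemma measurable_ratio_enn [measurable (raw)]:
  assumes [measurable]: "a \<in> borel_measurable N" "b \<in> borel_measurable N"
  shows "(\<lambda>x. ratio_enn (a x) (b x)) \<in> borel_measurable N"
  unfolding ratio_enn_def by measurable

lemma Ssum_shift [simp]: "Ssum (shift h f) = Ssum f"
  unfolding Ssum_eq_nn_integral shift_def by (rule nn_integral_count_space_translate)

lemma Bcnt_shift [simp]: "Bcnt (shift h f) = Bcnt f"
  unfolding Bcnt_eq_nn_integral shift_def by (rule nn_integral_count_space_translate)

lemma Mx_shift [simp]: "Mx (shift h f) = Mx f"
proof -
  have "(\<lambda>t. ennreal (f (t - h))) ` UNIV = (\<lambda>t. ennreal (f t)) ` UNIV"
    using image_comp[of "\<lambda>t. ennreal (f t)" "\<lambda>t. t - h" UNIV] by (simp add: comp_def surj_diff_right)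
  then show ?thesis by (simp add: Mx_def shift_def)
qed

lemma ratio_enn_nonneg: "0 \<le> ratio_enn a b"
  by (simp add: ratio_enn_def)

text \<open>Covers an infinite exceedance set too: \<open>card\<close> is then \<open>0\<close>, and
  division by zero returns \<open>0\<close>, in agreement with the convention 1/\<infinity> =
  0.\<close>

lemma ratio_enn_1_Bcnt: "ratio_enn 1 (Bcnt f) = 1 / real (card {t. f t > 1})"
  by (auto simp: ratio_enn_def Bcnt_def)

lemma ratio_enn_1_le_1: "ratio_enn 1 (Bcnt f) \<le> 1"
  by (cases "card {t. f t > 1} = 0") (simp_all add: ratio_enn_1_Bcnt del: card_eq_0_iff)

lemma Mx_gt_1_iff: "Mx f > 1 \<longleftrightarrow> (\<exists>t. f t > 1)"
  by (simp add: Mx_def less_SUP_iff)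

lemma Mx_le_Ssum: "Mx f \<le> Ssum f"
  unfolding Mx_def Ssum_eq_nn_integral
  by (rule SUP_least) (rule nn_integral_ge_point, simp)

text \<open>Markov's inequality for counting measure.\<close>

lemma Ssum_finite_level_set:
  assumes "Ssum f < \<top>" "c > 0"
  shows "finite {t. f t \<ge> c}"
proof (rule ccontr)
  assume inf: "infinite {t. f t \<ge> c}"
  have "\<top> = ennreal c * emeasure (count_space UNIV) {t. f t \<ge> c}"
    using inf assms(2) by (simp add: ennreal_mult_top)
  also have "\<dots> = (\<integral>\<^sup>+t. ennreal c * indicator {t. f t \<ge> c} t \<partial>count_space UNIV)"
    by (simp add: nn_integral_cmult_indicator)
  also have "\<dots> \<le> Ssum f"
    unfolding Ssum_eq_nn_integral
    by (intro nn_integral_mono) (auto simp: indicator_def intro: ennreal_leI)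
  finally show False using assms(1) by auto
qed

lemma Ssum_finite_imp_Bcnt_finite: "Ssum f < \<top> \<Longrightarrow> Bcnt f < \<top>"
  using Ssum_finite_level_set[of f 1] finite_subset[of "{t. f t > 1}" "{t. f t \<ge> 1}"]
  by (auto simp: Bcnt_def less_top[symmetric] subset_eq)

lemma Bcnt_finite_imp_Mx_finite:
  assumes "Bcnt f < \<top>" shows "Mx f < \<top>"
proof -
  have fin: "finite {t. f t > 1}"
    using assms by (auto simp: Bcnt_def split: if_splits)
  \<comment> \<open>The inserted \<open>1\<close> bounds all entries that are not exceedances and
    keeps \<open>Max\<close> meaningful when there is no exceedance.\<close>
  define c where "c = Max (insert 1 (f ` {t. f t > 1}))"
  have "f t \<le> c" for t
    unfolding c_def using fin by (cases "f t > 1") (auto intro!: Max_ge simp: Max_ge_iff)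
  then have "Mx f \<le> ennreal c"
    unfolding Mx_def by (intro SUP_least ennreal_leI) auto
  then show ?thesis by (auto simp: less_top[symmetric] top_unique)
qed

text \<open>Each exceedance receives mass 1/B. The total is 1 unless B is 0 or \<infinity>, and in
  both of these cases the conventions make it 0.\<close>

lemma nn_integral_exceedance_weight:
  "(\<integral>\<^sup>+t. indicator {1<..} (f t) * ennreal (ratio_enn 1 (Bcnt f)) \<partial>count_space UNIV)
     = indicator {f. 0 < Bcnt f \<and> Bcnt f < \<top>} (f :: 'd::finite field)"
proof -
  have "(\<integral>\<^sup>+t. indicator {1<..} (f t) * ennreal (ratio_enn 1 (Bcnt f)) \<partial>count_space UNIV)
      = Bcnt f * ennreal (ratio_enn 1 (Bcnt f))"
    by (simp add: nn_integral_multc Bcnt_eq_nn_integral)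
  also have "\<dots> = indicator {f. 0 < Bcnt f \<and> Bcnt f < \<top>} f"
  proof (cases "finite {t. f t > 1}")
    case False
    then show ?thesis by (simp add: ratio_enn_def Bcnt_def)
  next
    case True
    show ?thesis
    proof (cases "card {t. f t > 1} = 0")
      case True
      with \<open>finite _\<close> have "Bcnt f = 0" by (auto simp: Bcnt_def)
      then show ?thesis by simp
    next
      case False
      have "Bcnt f = ennreal (real (card {t. f t > 1}))"
        using True by (simp add: Bcnt_def ennreal_of_nat_eq_real_of_nat)
      moreover have "ratio_enn 1 (Bcnt f) = 1 / real (card {t. f t > 1})"
        by (rule ratio_enn_1_Bcnt)
      ultimately show ?thesis
        using False by (auto simp: ennreal_mult[symmetric] simp del: card_eq_0_iff)
    qed
  qed
  finally show ?thesis .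
qed

text \<open>The orbit sum is the lattice sum reflected at the origin, and the shift-invariant factor
  \<open>g\<close> comes out of it. In the applications \<open>g\<close> is the indicator of bounded
  \<open>Mx\<close> or of finite \<open>Ssum\<close>.\<close>

lemma nn_integral_exceedance_weight_shift:
  fixes f :: "'d::finite field"
  assumes "\<And>t. g (shift t f) = g f"
  shows "(\<integral>\<^sup>+t. indicator {1<..} (shift t f 0) * ennreal (ratio_enn 1 (Bcnt (shift t f))) * g (shift t f)
            \<partial>count_space UNIV)
      = indicator {f. 0 < Bcnt f \<and> Bcnt f < \<top>} f * g f"
  using nn_integral_count_space_uminus[of "\<lambda>t. indicator {1<..} (f t) * ennreal (ratio_enn 1 (Bcnt f))"]
  by (simp add: assms nn_integral_multc nn_integral_exceedance_weight[symmetric])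

lemma Collect_in_sets_PE: "Measurable.pred PE Q \<Longrightarrow> {f. Q f} \<in> sets PE"
  by (simp add: pred_def)

lemma Bcnt_pos_iff: "0 < Bcnt f \<longleftrightarrow> 1 < Mx f"
proof -
  have "Bcnt f = 0 \<longleftrightarrow> {t. f t > 1} = {}"
    using infinite_imp_nonempty by (auto simp: Bcnt_def)
  then show ?thesis
    by (auto simp: Mx_gt_1_iff zero_less_iff_neq_zero)
qed

lemma finite_card_int_box:
  fixes a b :: int
  shows "finite {t::int^'d::finite. \<forall>i. a \<le> t $ i \<and> t $ i \<le> b}" (is "finite ?B")
    and "card {t::int^'d::finite. \<forall>i. a \<le> t $ i \<and> t $ i \<le> b} = nat (b - a + 1) ^ CARD('d)"
proof -
  have bij: "bij_betw vec_nth ?B (Pi\<^sub>E UNIV (\<lambda>_::'d. {a..b}))"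
    by (rule bij_betwI[where g = vec_lambda]) auto
  have "finite (Pi\<^sub>E UNIV (\<lambda>_::'d. {a..b}))"
    by (intro finite_PiE) auto
  then show "finite ?B"
    using bij_betw_finite[OF bij] by simp
  show "card ?B = nat (b - a + 1) ^ CARD('d)"
    using bij_betw_same_card[OF bij] by (simp add: card_PiE)
qed

section \<open>Shift-invariant tail measures\<close>

text \<open>These are the properties of the exponent measure that the orbit arguments draw on;
  \<open>X\<close> and \<open>Z\<close> no longer appear. The cap \<open>c\<close> in the last one
  is essential for an exponent measure, because the uncapped integral is infinite.\<close>

locale tail_measure =
  fixes \<nu> :: "'d::finite field measure"
  assumes sets_eq_PE [measurable_cong]: "sets \<nu> = sets PE"
    and distr_shift: "\<And>h. distr \<nu> PE (shift h) = \<nu>"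
    and AE_nonneg: "AE f in \<nu>. \<forall>t. 0 \<le> f t"
    and AE_neq_1_at_0: "AE f in \<nu>. f 0 \<noteq> 1"
    and emeasure_exceedance_at_0: "emeasure \<nu> {f. f 0 > 1} = 1"
    and nn_integral_truncated:
      "\<And>c::nat. (\<integral>\<^sup>+f. ennreal (f 0) * indicator {f. 1 < Mx f \<and> Mx f \<le> of_nat c} f \<partial>\<nu>) < \<top>"
begin

section \<open>Invariance and mass transport\<close>

lemma space_eq_UNIV [simp]: "space \<nu> = UNIV"
  using sets_eq_imp_space_eq[OF sets_eq_PE] by simp

lemma nn_integral_shift:
  assumes "F \<in> borel_measurable PE"
  shows "(\<integral>\<^sup>+f. F (shift h f) \<partial>\<nu>) = (\<integral>\<^sup>+f. F f \<partial>\<nu>)"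
proof -
  have "(\<integral>\<^sup>+f. F f \<partial>\<nu>) = (\<integral>\<^sup>+f. F f \<partial>distr \<nu> PE (shift h))"
    by (simp add: distr_shift)
  also have "\<dots> = (\<integral>\<^sup>+f. F (shift h f) \<partial>\<nu>)"
    using assms by (intro nn_integral_distr) measurable
  finally show ?thesis ..
qed

text \<open>Invariance carries a null set to each of its shifts, and there are only countably many
  of them. A property known at the origin thus spreads to the whole orbit.\<close>

lemma AE_shift:
  assumes "AE f in \<nu>. Q f"
  shows "AE f in \<nu>. \<forall>h. Q (shift h f)"
proof -
  have "AE f in \<nu>. Q (shift h f)" for h
  proof (rule AE_distrD[where P = Q and M' = PE])
    show "shift h \<in> measurable \<nu> PE" by measurable
    show "AE f in distr \<nu> PE (shift h). Q f" by (subst distr_shift) (rule assms)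
  qed
  then show ?thesis by (simp add: AE_all_countable)
qed

text \<open>With the sum taken outside, the shift by \<open>- t\<close> turns w(f) v(B^t f) into
  w(B^(-t) f) v(f), and the reflection of \<open>t\<close> restores the form of the sum.\<close>

lemma mass_transport:
  assumes [measurable]: "w \<in> borel_measurable PE" "v \<in> borel_measurable PE"
  shows "(\<integral>\<^sup>+f. w f * (\<integral>\<^sup>+t. v (shift t f) \<partial>count_space UNIV) \<partial>\<nu>)
       = (\<integral>\<^sup>+f. (\<integral>\<^sup>+t. w (shift t f) \<partial>count_space UNIV) * v f \<partial>\<nu>)"
proof -
  have "(\<integral>\<^sup>+f. w f * (\<integral>\<^sup>+t. v (shift t f) \<partial>count_space UNIV) \<partial>\<nu>)
      = (\<integral>\<^sup>+f. (\<integral>\<^sup>+t. w f * v (shift t f) \<partial>count_space UNIV) \<partial>\<nu>)"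
    by (simp add: nn_integral_cmult)
  also have "\<dots> = (\<integral>\<^sup>+t. (\<integral>\<^sup>+f. w f * v (shift t f) \<partial>\<nu>) \<partial>count_space UNIV)"
    by (rule nn_integral_count_space_nn_integral) auto
  also have "\<dots> = (\<integral>\<^sup>+t. (\<integral>\<^sup>+f. w (shift (- t) f) * v f \<partial>\<nu>) \<partial>count_space UNIV)"
  proof (rule nn_integral_cong)
    fix t
    show "(\<integral>\<^sup>+f. w f * v (shift t f) \<partial>\<nu>) = (\<integral>\<^sup>+f. w (shift (- t) f) * v f \<partial>\<nu>)"
      using nn_integral_shift[of "\<lambda>f. w f * v (shift t f)" "- t"] by simp
  qed
  also have "\<dots> = (\<integral>\<^sup>+t. (\<integral>\<^sup>+f. w (shift t f) * v f \<partial>\<nu>) \<partial>count_space UNIV)"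
    by (rule nn_integral_count_space_uminus)
  also have "\<dots> = (\<integral>\<^sup>+f. (\<integral>\<^sup>+t. w (shift t f) * v f \<partial>count_space UNIV) \<partial>\<nu>)"
    by (rule nn_integral_count_space_nn_integral[symmetric]) auto
  also have "\<dots> = (\<integral>\<^sup>+f. (\<integral>\<^sup>+t. w (shift t f) \<partial>count_space UNIV) * v f \<partial>\<nu>)"
    by (simp add: nn_integral_multc)
  finally show ?thesis .
qed

section \<open>The tail law and weights on orbits\<close>

definition tail_law :: "'d field measure" where
  "tail_law = density \<nu> (\<lambda>f. indicator {1<..} (f 0))"

definition theta :: real where
  "theta = (\<integral>f. ratio_enn 1 (Bcnt f) \<partial>tail_law)"

lemma sets_tail_law [measurable_cong, simp]: "sets tail_law = sets PE"
  by (simp add: tail_law_def sets_eq_PE)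

lemma space_tail_law [simp]: "space tail_law = UNIV"
  by (simp add: tail_law_def)

lemma nn_integral_tail_law:
  assumes [measurable]: "F \<in> borel_measurable PE"
  shows "(\<integral>\<^sup>+f. F f \<partial>tail_law) = (\<integral>\<^sup>+f. indicator {1<..} (f 0) * F f \<partial>\<nu>)"
  unfolding tail_law_def by (rule nn_integral_density) measurable

lemma AE_tail_law_iff: "(AE f in tail_law. Q f) \<longleftrightarrow> (AE f in \<nu>. f 0 > 1 \<longrightarrow> Q f)"
proof -
  have "(AE f in tail_law. Q f) \<longleftrightarrow> (AE f in \<nu>. 0 < (indicator {1<..} (f 0) :: ennreal) \<longrightarrow> Q f)"
    unfolding tail_law_def by (rule AE_density) measurable
  also have "\<dots> \<longleftrightarrow> (AE f in \<nu>. f 0 > 1 \<longrightarrow> Q f)"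
    by (intro AE_cong) (auto simp: indicator_def)
  finally show ?thesis .
qed

lemma prob_space_tail_law: "prob_space tail_law"
proof
  have "emeasure tail_law (space tail_law) = (\<integral>\<^sup>+f. 1 \<partial>tail_law)"
    by simp
  also have "\<dots> = (\<integral>\<^sup>+f. indicator {f. f 0 > 1} f \<partial>\<nu>)"
    by (subst nn_integral_tail_law) (auto intro!: nn_integral_cong simp: indicator_def)
  also have "\<dots> = emeasure \<nu> {f. f 0 > 1}"
    by (rule nn_integral_indicator) (simp add: sets_eq_PE Collect_in_sets_PE)
  finally show "emeasure tail_law (space tail_law) = 1"
    by (simp add: emeasure_exceedance_at_0)
qed

sublocale tail: prob_space tail_law
  by (rule prob_space_tail_law)

lemma theta_nonneg: "0 \<le> theta"
  unfolding theta_def by (intro integral_nonneg_AE) (simp add: ratio_enn_nonneg)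

lemma ennreal_theta:
  "ennreal theta = (\<integral>\<^sup>+f. indicator {1<..} (f 0) * ennreal (ratio_enn 1 (Bcnt f)) \<partial>\<nu>)"
proof -
  have "ennreal theta = (\<integral>\<^sup>+f. ennreal (ratio_enn 1 (Bcnt f)) \<partial>tail_law)"
    unfolding theta_def
    by (rule nn_integral_eq_integral[symmetric])
       (auto intro!: tail.integrable_const_bound[where B = 1] simp: ratio_enn_nonneg ratio_enn_1_le_1)
  then show ?thesis by (simp add: nn_integral_tail_law)
qed

lemma AE_Ssum_finite_of_Bcnt_finite: "AE f in \<nu>. f 0 > 1 \<longrightarrow> Bcnt f < \<top> \<longrightarrow> Ssum f < \<top>"
proof -
  have "AE f in \<nu>. f 0 > 1 \<and> Bcnt f < \<top> \<and> Mx f \<le> of_nat c \<longrightarrow> Ssum f < \<top>" for c :: nat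
  proof -
    \<comment> \<open>The cap on \<open>Mx\<close> is shift invariant, so it survives the orbit sum,
      and it brings the transported integral within reach of
      \<open>nn_integral_truncated\<close>.\<close>
    define w :: "'d field \<Rightarrow> ennreal" where
      "w f = indicator {1<..} (f 0) * ennreal (ratio_enn 1 (Bcnt f)) * indicator {f. Mx f \<le> of_nat c} f" for f
    have [measurable]: "w \<in> borel_measurable PE"
      unfolding w_def by measurable
    have sum_w: "(\<integral>\<^sup>+t. w (shift t f) \<partial>count_space UNIV)
        = indicator {f. 0 < Bcnt f \<and> Bcnt f < \<top>} f * indicator {f. Mx f \<le> of_nat c} f" for f
      unfolding w_def by (rule nn_integral_exceedance_weight_shift) (simp add: indicator_def)
    have sum_v: "(\<integral>\<^sup>+t. ennreal (shift t f 0) \<partial>count_space UNIV) = Ssum f" for f :: "'d field"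
      using nn_integral_count_space_uminus[of "\<lambda>t. ennreal (f t)"] by (simp add: Ssum_eq_nn_integral)
    have "(\<integral>\<^sup>+f. w f * Ssum f \<partial>\<nu>)
        = (\<integral>\<^sup>+f. indicator {f. 0 < Bcnt f \<and> Bcnt f < \<top>} f * indicator {f. Mx f \<le> of_nat c} f * ennreal (f 0) \<partial>\<nu>)"
      using mass_transport[of w "\<lambda>f. ennreal (f 0)"] by (simp only: sum_v sum_w) simp
    also have "\<dots> \<le> (\<integral>\<^sup>+f. ennreal (f 0) * indicator {f. 1 < Mx f \<and> Mx f \<le> of_nat c} f \<partial>\<nu>)"
      by (intro nn_integral_mono) (auto simp: indicator_def Bcnt_pos_iff)
    also have "\<dots> < \<top>" by (rule nn_integral_truncated)
    \<comment> \<open>A finite integral forces a finite integrand almost everywhere. Since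
      \<open>w\<close> is positive on the event considered below, the finiteness passes to
      \<open>Ssum\<close>.\<close>
    finally have "AE f in \<nu>. w f * Ssum f \<noteq> \<infinity>"
      by (intro nn_integral_PInf_AE) (auto simp: less_top)
    then show ?thesis
    proof (rule AE_mp, intro AE_I2 impI)
      fix f assume *: "w f * Ssum f \<noteq> \<infinity>" and f: "f 0 > 1 \<and> Bcnt f < \<top> \<and> Mx f \<le> of_nat c"
      then have "0 < Bcnt f" "Bcnt f < \<top>"
        by (auto simp: Bcnt_pos_iff Mx_gt_1_iff)
      then have "w f \<noteq> 0"
        using f by (auto simp: w_def ratio_enn_def enn2real_eq_0_iff enn2real_positive_iff)
      with * show "Ssum f < \<top>"
        by (auto simp: less_top[symmetric] ennreal_mult_top)
    qed
  qed
  then have "AE f in \<nu>. \<forall>c::nat. f 0 > 1 \<and> Bcnt f < \<top> \<and> Mx f \<le> of_nat c \<longrightarrow> Ssum f < \<top>"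
    by (subst AE_all_countable) blast
  then show ?thesis
  proof (rule AE_mp, intro AE_I2 impI)
    fix f assume *: "\<forall>c::nat. f 0 > 1 \<and> Bcnt f < \<top> \<and> Mx f \<le> of_nat c \<longrightarrow> Ssum f < \<top>"
      and f: "f 0 > 1" "Bcnt f < \<top>"
    \<comment> \<open>Finitely many exceedances bound the field, so some integer cap applies to each
      such \<open>f\<close>.\<close>
    obtain c :: nat where "Mx f < of_nat c"
      using Bcnt_finite_imp_Mx_finite[OF f(2)] ennreal_Ex_less_of_nat by auto
    with * f show "Ssum f < \<top>" by (auto intro: less_imp_le)
  qed
qed

lemma AE_Bcnt_finite_iff_Ssum_finite: "AE f in tail_law. Bcnt f < \<top> \<longleftrightarrow> Ssum f < \<top>"
  unfolding AE_tail_law_iff using AE_Ssum_finite_of_Bcnt_finite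
  by eventually_elim (auto intro: Ssum_finite_imp_Bcnt_finite)

text \<open>\<open>w\<close> and the reference weight \<open>v\<close> have the same orbit sum,
  namely the indicator of the invariant event \<open>D\<close>. Transport exchanges them, and each
  weight already vanishes outside \<open>D\<close>, at least almost everywhere.\<close>

lemma nn_integral_weight_eq_theta:
  assumes [measurable]: "w \<in> borel_measurable PE"
    and sum_w: "AE f in \<nu>. (\<integral>\<^sup>+t. w (shift t f) \<partial>count_space UNIV)
                    = indicator {f. 1 < Mx f \<and> Ssum f < \<top>} f"
  shows "(\<integral>\<^sup>+f. w f \<partial>\<nu>) = ennreal theta"
proof -
  define v :: "'d field \<Rightarrow> ennreal" where
    "v f = indicator {1<..} (f 0) * ennreal (ratio_enn 1 (Bcnt f)) * indicator {f. Ssum f < \<top>} f" for f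
  define D where "D = {f :: 'd field. 1 < Mx f \<and> Ssum f < \<top>}"
  have [measurable]: "v \<in> borel_measurable PE"
    unfolding v_def by measurable
  have sum_v: "(\<integral>\<^sup>+t. v (shift t f) \<partial>count_space UNIV) = indicator D f" for f
    unfolding v_def by (subst nn_integral_exceedance_weight_shift)
      (auto simp: D_def indicator_def Bcnt_pos_iff intro: Ssum_finite_imp_Bcnt_finite)
  have "(\<integral>\<^sup>+f. w f \<partial>\<nu>) = (\<integral>\<^sup>+f. w f * indicator D f \<partial>\<nu>)"
  proof (rule nn_integral_cong_AE, use sum_w in eventually_elim)
    fix f assume *: "(\<integral>\<^sup>+t. w (shift t f) \<partial>count_space UNIV) = indicator {f. 1 < Mx f \<and> Ssum f < \<top>} f"
    \<comment> \<open>\<open>w f\<close> is the term \<open>t = 0\<close> of its orbit sum, hence it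
      is zero wherever that sum is zero.\<close>
    have "w f \<le> (\<integral>\<^sup>+t. w (shift t f) \<partial>count_space UNIV)"
      using nn_integral_ge_point[of 0 UNIV "\<lambda>t. w (shift t f)"] by simp
    with * show "w f = w f * indicator D f"
      by (auto simp: D_def indicator_def split: if_splits)
  qed
  also have "\<dots> = (\<integral>\<^sup>+f. (\<integral>\<^sup>+t. w (shift t f) \<partial>count_space UNIV) * v f \<partial>\<nu>)"
    using mass_transport[of w v] by (simp add: sum_v)
  also have "\<dots> = (\<integral>\<^sup>+f. v f \<partial>\<nu>)"
    by (rule nn_integral_cong_AE, use sum_w in eventually_elim)
       (auto simp: v_def indicator_def Mx_gt_1_iff)
  \<comment> \<open>Dropping the indicator of finite \<open>Ssum\<close> changes nothing: if
    \<open>Bcnt f\<close> is infinite both integrands vanish, and if it is finite, then so is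
    \<open>Ssum f\<close> for almost every \<open>f\<close> with \<open>f 0 > 1\<close>.\<close>
  also have "\<dots> = ennreal theta"
    unfolding ennreal_theta
    by (rule nn_integral_cong_AE, use AE_Ssum_finite_of_Bcnt_finite in eventually_elim)
       (auto simp: v_def indicator_def ratio_enn_def less_top)
  finally show ?thesis .
qed

lemma nn_integral_mass_fraction_eq_theta:
  "(\<integral>\<^sup>+f. ennreal (f 0) / Ssum f * indicator {f. 1 < Mx f \<and> Ssum f < \<top>} f \<partial>\<nu>) = ennreal theta"
proof (rule nn_integral_weight_eq_theta)
  show "AE f in \<nu>. (\<integral>\<^sup>+t. ennreal (shift t f 0) / Ssum (shift t f)
          * indicator {f. 1 < Mx f \<and> Ssum f < \<top>} (shift t f) \<partial>count_space UNIV)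
      = indicator {f. 1 < Mx f \<and> Ssum f < \<top>} f"
  proof (intro AE_I2)
    fix f :: "'d field"
    have "(\<integral>\<^sup>+t. ennreal (shift t f 0) / Ssum (shift t f)
          * indicator {f. 1 < Mx f \<and> Ssum f < \<top>} (shift t f) \<partial>count_space UNIV)
      = Ssum f / Ssum f * indicator {f. 1 < Mx f \<and> Ssum f < \<top>} f"
    proof -
      have "indicator {f. 1 < Mx f \<and> Ssum f < \<top>} (shift t f)
          = (indicator {f. 1 < Mx f \<and> Ssum f < \<top>} f :: ennreal)" for t
        by (simp add: indicator_def)
      then show ?thesis
        using nn_integral_count_space_uminus[of "\<lambda>t. ennreal (f t)"]
        by (simp add: nn_integral_multc divide_ennreal_def Ssum_eq_nn_integral[of f, symmetric])
    qed
    also have "\<dots> = indicator {f. 1 < Mx f \<and> Ssum f < \<top>} f"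
      \<comment> \<open>On the event \<open>Ssum f\<close> exceeds 1, so the quotient is a genuine 1
        and not 0/0.\<close>
      using Mx_le_Ssum[of f] by (auto simp: indicator_def intro!: ennreal_divide_self)
    finally show "(\<integral>\<^sup>+t. ennreal (shift t f 0) / Ssum (shift t f)
          * indicator {f. 1 < Mx f \<and> Ssum f < \<top>} (shift t f) \<partial>count_space UNIV)
      = indicator {f. 1 < Mx f \<and> Ssum f < \<top>} f" .
  qed
qed measurable

text \<open>Along an orbit with finite S and some exceedance, exactly one shift moves the anchor to
  the origin, so the event \<open>?A\<close> intersected with f(0) > 1 is a weight with the required
  orbit sum. Equivariance and the lower bound are separate hypotheses so that the abstract map,
  \<open>IA\<close> and \<open>Ife\<close> are all covered.\<close>

lemma anchoring_probability_eq_theta: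
  assumes meas [measurable]: "{f. I f = Some 0 \<and> Ssum f < \<top>} \<in> sets PE"
    and equiv: "\<And>f j i. \<forall>t. 0 \<le> f t \<Longrightarrow> I f = Some j \<Longrightarrow> I (shift i f) = Some (j + i)"
    and bound: "\<And>f j. \<forall>t. 0 \<le> f t \<Longrightarrow> I f = Some j \<Longrightarrow> min (f 0) 1 \<le> f j"
    and fin: "AE f in tail_law. Ssum f < \<top> \<longrightarrow> I f \<noteq> None"
  shows "measure tail_law {f. I f = Some 0 \<and> Ssum f < \<top>} = theta"
proof -
  let ?A = "{f. I f = Some 0 \<and> Ssum f < \<top>}"
  have "(\<integral>\<^sup>+f. indicator {1<..} (f 0) * indicator ?A f \<partial>\<nu>) = ennreal theta"
  proof (rule nn_integral_weight_eq_theta)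
    show "AE f in \<nu>. (\<integral>\<^sup>+t. indicator {1<..} (shift t f 0) * indicator ?A (shift t f) \<partial>count_space UNIV)
          = indicator {f. 1 < Mx f \<and> Ssum f < \<top>} f"
      \<comment> \<open>Being defined is known only for fields with an exceedance at the origin;
        along the orbit it becomes available for a field recentred at any of its
        exceedances.\<close>
      using AE_nonneg AE_shift[OF AE_neq_1_at_0] AE_shift[OF fin[unfolded AE_tail_law_iff]]
    proof eventually_elim
      fix f :: "'d field"
      assume nn: "\<forall>t. 0 \<le> f t" and neq: "\<forall>h. shift h f 0 \<noteq> 1"
        and def: "\<forall>h. 1 < shift h f 0 \<longrightarrow> Ssum (shift h f) < \<top> \<longrightarrow> I (shift h f) \<noteq> None"
      have anchor: "I (shift h f) = Some j \<longleftrightarrow> I f = Some (j - h)" for h j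
      proof
        assume "I (shift h f) = Some j"
        from equiv[OF shift_nonneg[OF nn] this, of "- h"] show "I f = Some (j - h)" by simp
      next
        assume "I f = Some (j - h)"
        from equiv[OF nn this, of h] show "I (shift h f) = Some j" by simp
      qed
      show "(\<integral>\<^sup>+t. indicator {1<..} (shift t f 0) * indicator ?A (shift t f) \<partial>count_space UNIV)
          = indicator {f. 1 < Mx f \<and> Ssum f < \<top>} f"
      proof (cases "1 < Mx f \<and> Ssum f < \<top>")
        case False
        have "(indicator {1<..} (shift t f 0) * indicator ?A (shift t f) :: ennreal) = 0" for t
          using False by (auto simp: indicator_def Mx_gt_1_iff)
        then have "(\<integral>\<^sup>+t. indicator {1<..} (shift t f 0) * indicator ?A (shift t f) \<partial>count_space UNIV) = 0"
          by (simp only: nn_integral_const) simp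
        then show ?thesis using False by simp
      next
        case True
        then obtain s where s: "f s > 1" by (auto simp: Mx_gt_1_iff)
        with def[rule_format, of "- s"] True have "I (shift (- s) f) \<noteq> None" by simp
        then obtain j where j: "I f = Some j" using anchor by force
        have "I (shift (- s) f) = Some (j - s)" using anchor j by simp
        \<comment> \<open>The lower bound is used for the field recentred at the exceedance
          \<open>s\<close>, where the minimum with 1 equals 1. The next line removes the tie at
          level 1.\<close>
        from bound[OF shift_nonneg[OF nn] this] s have "f j \<ge> 1"
          by (simp add: shift_def)
        moreover have "f j \<noteq> 1" using neq[rule_format, of "- j"] by simp
        ultimately have fj: "f j > 1" by simp
        have "(indicator {1<..} (shift t f 0) * indicator ?A (shift t f) :: ennreal)
            = indicator {- j} t" for t
        proof -
          have "t = - j" if "j = - t" using that by simp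
          then show ?thesis using True fj by (auto simp: indicator_def anchor j)
        qed
        then show ?thesis using True by simp
      qed
    qed
  qed measurable
  then have "emeasure tail_law ?A = ennreal theta"
    using nn_integral_tail_law[of "indicator ?A"] by simp
  then show ?thesis by (simp add: measure_def theta_nonneg)
qed

section \<open>Exceedances in finite windows and the limit over growing cubes\<close>

definition finite_theta :: "(int ^ 'd) set \<Rightarrow> real" where
  "finite_theta D = (\<integral>f. 1 / real (card {t\<in>D. f t > 1}) \<partial>tail_law)"

lemma measurable_card_exceedances [measurable]:
  assumes "finite D"
  shows "(\<lambda>f. real (card {t\<in>D. f t > 1})) \<in> borel_measurable (PE :: 'd field measure)"
proof -
  have "real (card {t\<in>D. f t > 1}) = (\<Sum>t\<in>D. indicator {1<..} (f t))" for f :: "'d field"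
    using assms by (simp add: indicator_def sum.If_cases Int_def of_bool_def)
  then show ?thesis by simp
qed

lemma inverse_card_exceedances_le_1: "1 / real (card {t\<in>D. f t > 1}) \<le> 1"
  by (cases "card {t\<in>D. f t > 1}") auto

lemma integrable_inverse_card_exceedances:
  assumes "finite D"
  shows "integrable tail_law (\<lambda>f. 1 / real (card {t\<in>D. f t > 1}))"
  using measurable_card_exceedances[OF assms]
  by (intro tail.integrable_const_bound[where B = 1]) (auto simp: inverse_card_exceedances_le_1)

lemma integrable_ratio_Bcnt: "integrable tail_law (\<lambda>f. ratio_enn 1 (Bcnt f))"
  by (intro tail.integrable_const_bound[where B = 1]) (auto simp: ratio_enn_nonneg ratio_enn_1_le_1)

lemma finite_theta_le_1: "finite D \<Longrightarrow> finite_theta D \<le> 1"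
  unfolding finite_theta_def
  using integral_mono[OF integrable_inverse_card_exceedances, of D "\<lambda>_. 1"]
  by (simp add: inverse_card_exceedances_le_1 tail.prob_space[simplified])

lemma AE_tail_law_gt_1: "AE f in tail_law. f 0 > 1"
  by (simp add: AE_tail_law_iff)

text \<open>A larger window contains more exceedances. The origin must lie in \<open>C\<close>:
  under \<open>tail_law\<close> it is an exceedance, so both counts are positive and 1/0 = 0 cannot
  break the monotonicity.\<close>

lemma finite_theta_antimono:
  assumes "finite D" "C \<subseteq> D" "0 \<in> C"
  shows "finite_theta D \<le> finite_theta C"
  unfolding finite_theta_def
proof (rule integral_mono_AE)
  show "AE f in tail_law. 1 / real (card {t\<in>D. f t > 1}) \<le> 1 / real (card {t\<in>C. f t > 1})"
    using AE_tail_law_gt_1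
  proof eventually_elim
    fix f :: "'d field" assume "f 0 > 1"
    then have "0 < card {t\<in>C. f t > 1}"
      using assms by (auto simp: card_gt_0_iff intro: finite_subset)
    moreover have "card {t\<in>C. f t > 1} \<le> card {t\<in>D. f t > 1}"
      using assms by (intro card_mono) auto
    ultimately show "1 / real (card {t\<in>D. f t > 1}) \<le> 1 / real (card {t\<in>C. f t > 1})"
      by (intro divide_left_mono) auto
  qed
qed (use assms in \<open>auto intro!: integrable_inverse_card_exceedances intro: finite_subset\<close>)

lemma theta_le_finite_theta:
  assumes "finite D" "0 \<in> D"
  shows "theta \<le> finite_theta D"
  unfolding finite_theta_def theta_def
proof (rule integral_mono_AE)
  show "AE f in tail_law. ratio_enn 1 (Bcnt f) \<le> 1 / real (card {t\<in>D. f t > 1})"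
    using AE_tail_law_gt_1
  proof eventually_elim
    fix f :: "'d field" assume "f 0 > 1"
    then have "0 < card {t\<in>D. f t > 1}"
      using assms by (auto simp: card_gt_0_iff)
    moreover have "card {t\<in>D. f t > 1} \<le> card {t. f t > 1}" if "finite {t. f t > 1}"
      using that by (intro card_mono) auto
    ultimately show "ratio_enn 1 (Bcnt f) \<le> 1 / real (card {t\<in>D. f t > 1})"
      unfolding ratio_enn_1_Bcnt
      by (cases "finite {t. f t > 1}") (auto intro!: divide_left_mono mult_pos_pos intro: less_le_trans)
  qed
qed (use assms in \<open>auto intro!: integrable_inverse_card_exceedances integrable_ratio_Bcnt\<close>)

text \<open>Centred windows are the ones that remain inside a large cube when it is recentred at any
  site of depth at least \<open>k\<close>.\<close>

definition sym_cube :: "nat \<Rightarrow> (int ^ 'd) set" where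
  "sym_cube k = {t. \<forall>i. - int k \<le> t $ i \<and> t $ i \<le> int k}"

lemma finite_sym_cube: "finite (sym_cube k)"
  unfolding sym_cube_def by (rule finite_card_int_box)

lemma sym_cube_mono: "k \<le> l \<Longrightarrow> sym_cube k \<subseteq> sym_cube l"
  unfolding sym_cube_def by (smt (verit) Collect_mono of_nat_mono)

lemma finite_subset_sym_cube:
  assumes "finite F"
  obtains k where "F \<subseteq> sym_cube k"
proof -
  \<comment> \<open>A crude radius: the sum of all absolute coordinates dominates each one of
    them.\<close>
  define k where "k = (\<Sum>t\<in>F. \<Sum>i\<in>UNIV. nat \<bar>t $ i\<bar>)"
  have "F \<subseteq> sym_cube k"
  proof
    fix t assume t: "t \<in> F"
    have "nat \<bar>t $ i\<bar> \<le> k" for i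
    proof -
      have "nat \<bar>t $ i\<bar> \<le> (\<Sum>i\<in>UNIV. nat \<bar>t $ i\<bar>)"
        by (rule member_le_sum) auto
      also have "\<dots> \<le> k"
        unfolding k_def using t assms by (intro member_le_sum[where f = "\<lambda>t. \<Sum>i\<in>UNIV. nat \<bar>t $ i\<bar>"]) auto
      finally show ?thesis .
    qed
    then show "t \<in> sym_cube k" by (simp add: sym_cube_def) (smt (verit, best) nat_le_iff)
  qed
  then show thesis by (rule that)
qed

text \<open>A finite exceedance set is eventually captured whole. An infinite one makes the counts
  unbounded, so the reciprocals tend to the conventional value 0.\<close>

lemma inverse_card_sym_cube_tendsto:
  "(\<lambda>k. 1 / real (card {t\<in>sym_cube k. f t > 1})) \<longlonglongrightarrow> ratio_enn 1 (Bcnt f)"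
proof (cases "finite {t. f t > 1}")
  case True
  then obtain k where k: "{t. f t > 1} \<subseteq> sym_cube k" by (rule finite_subset_sym_cube)
  have "{t\<in>sym_cube l. f t > 1} = {t. f t > 1}" if "l \<ge> k" for l
    using k sym_cube_mono[OF that] by auto
  then show ?thesis
    unfolding ratio_enn_1_Bcnt
    by (intro tendsto_eventually) (auto intro!: eventually_at_top_linorderI[of k])
next
  case False
  have "filterlim (\<lambda>k. real (card {t\<in>sym_cube k. f t > 1})) at_top sequentially"
  proof (rule filterlim_compose[OF filterlim_real_sequentially], subst filterlim_at_top, intro allI)
    fix n
    obtain F where F: "F \<subseteq> {t. f t > 1}" "finite F" "card F = n"
      using infinite_arbitrarily_large[OF False] by metis
    obtain k where k: "F \<subseteq> sym_cube k" using finite_subset_sym_cube[OF F(2)] .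
    have "n \<le> card {t\<in>sym_cube l. f t > 1}" if "l \<ge> k" for l
      unfolding F(3)[symmetric] using F(1) k sym_cube_mono[OF that]
      by (intro card_mono) (auto intro: finite_subset[OF _ finite_sym_cube])
    then show "\<forall>\<^sub>F l in sequentially. n \<le> card {t\<in>sym_cube l. f t > 1}"
      by (rule eventually_at_top_linorderI)
  qed
  then show ?thesis
    using False unfolding ratio_enn_1_Bcnt
    by (simp add: divide_inverse tendsto_inverse_0_at_top)
qed

lemma finite_theta_sym_cube_tendsto: "(\<lambda>k. finite_theta (sym_cube k)) \<longlonglongrightarrow> theta"
proof -
  note [measurable] = measurable_card_exceedances[OF finite_sym_cube]
  show ?thesis
    unfolding finite_theta_def theta_def
    by (rule integral_dominated_convergence[where w = "\<lambda>_. 1"])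
       (auto simp: inverse_card_sym_cube_tendsto inverse_card_exceedances_le_1)
qed

text \<open>Each exceedance in the window carries the reciprocal of their number. Invariance moves
  the carrying site \<open>s\<close> to the origin, which recentres the window at \<open>s\<close>
  and replaces \<open>\<nu>\<close> by the tail law.\<close>

lemma measure_exceedance_eq_sum:
  assumes "finite D"
  shows "measure \<nu> {f. \<exists>t\<in>D. f t > 1} = (\<Sum>s\<in>D. finite_theta ((\<lambda>t. t - s) ` D))"
proof -
  let ?N = "\<lambda>D f. card {t\<in>D. f t > 1}"
  note [measurable] = measurable_card_exceedances[OF assms]
  have "emeasure \<nu> {f. \<exists>t\<in>D. f t > 1} = (\<integral>\<^sup>+f. indicator {f. \<exists>t\<in>D. f t > 1} f \<partial>\<nu>)"
    using assms by (intro nn_integral_indicator[symmetric]) (simp add: sets_eq_PE Collect_in_sets_PE)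
  also have "\<dots> = (\<integral>\<^sup>+f. (\<Sum>s\<in>D. indicator {1<..} (f s) * ennreal (1 / real (?N D f))) \<partial>\<nu>)"
  proof (rule nn_integral_cong)
    fix f :: "'d field"
    have "(\<Sum>s\<in>D. indicator {1<..} (f s) * ennreal (1 / real (?N D f)))
        = of_nat (?N D f) * ennreal (1 / real (?N D f))"
      using assms by (simp add: sum_distrib_right[symmetric] indicator_def sum.If_cases Int_def of_bool_def)
    also have "\<dots> = ennreal (real (?N D f) * (1 / real (?N D f)))"
      by (subst ennreal_mult) (simp_all add: ennreal_of_nat_eq_real_of_nat)
    \<comment> \<open>For an empty count the product is 0 times 1/0, hence 0, as the indicator
      demands.\<close>
    also have "\<dots> = indicator {f. \<exists>t\<in>D. f t > 1} f"
      using assms by (auto simp: indicator_def)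
    finally show "indicator {f. \<exists>t\<in>D. f t > 1} f
        = (\<Sum>s\<in>D. indicator {1<..} (f s) * ennreal (1 / real (?N D f)))" ..
  qed
  also have "\<dots> = (\<Sum>s\<in>D. \<integral>\<^sup>+f. indicator {1<..} (f s) * ennreal (1 / real (?N D f)) \<partial>\<nu>)"
    by (rule nn_integral_sum) measurable
  also have "\<dots> = (\<Sum>s\<in>D. ennreal (finite_theta ((\<lambda>t. t - s) ` D)))"
  proof (rule sum.cong[OF refl])
    fix s
    let ?D = "(\<lambda>t. t - s) ` D"
    note [measurable] = measurable_card_exceedances[OF finite_imageI[OF assms]]
    have shift_self: "shift s f s = f 0" for f :: "'d field"
      by (simp add: shift_def)
    have "?N D (shift s f) = ?N ?D f" for f
    proof -
      have "{t\<in>?D. f t > 1} = (\<lambda>t. t - s) ` {t\<in>D. shift s f t > 1}"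
        by (auto simp: shift_def)
      then show ?thesis by (simp add: card_image inj_on_def)
    qed
    then have "(\<integral>\<^sup>+f. indicator {1<..} (f s) * ennreal (1 / real (?N D f)) \<partial>\<nu>)
        = (\<integral>\<^sup>+f. indicator {1<..} (f 0) * ennreal (1 / real (?N ?D f)) \<partial>\<nu>)"
      using nn_integral_shift[of "\<lambda>f. indicator {1<..} (f s) * ennreal (1 / real (?N D f))" s]
      by (simp add: shift_self)
    also have "\<dots> = (\<integral>\<^sup>+f. ennreal (1 / real (?N ?D f)) \<partial>tail_law)"
      by (simp add: nn_integral_tail_law)
    also have "\<dots> = ennreal (finite_theta ?D)"
      unfolding finite_theta_def
      by (rule nn_integral_eq_integral) (auto intro!: integrable_inverse_card_exceedances assms)
    finally show "(\<integral>\<^sup>+f. indicator {1<..} (f s) * ennreal (1 / real (?N D f)) \<partial>\<nu>) = ennreal (finite_theta ?D)" .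
  qed
  also have "\<dots> = ennreal (\<Sum>s\<in>D. finite_theta ((\<lambda>t. t - s) ` D))"
    by (rule sum_ennreal) (simp add: finite_theta_def)
  finally show ?thesis
    by (simp add: measure_def sum_nonneg finite_theta_def)
qed

lemma finite_cube: "finite (cube n :: (int ^ 'd) set)"
  and card_cube: "card (cube n :: (int ^ 'd) set) = (n + 1) ^ CARD('d)"
  using finite_card_int_box[of 0 "int n", where ?'d = 'd]
  by (simp_all add: cube_def nat_add_distrib)

text \<open>Every recentred cube contains the origin, so each of its (n+1)^d sites contributes at
  least \<open>theta\<close>.\<close>

lemma measure_cube_lower: "real (n + 1) ^ CARD('d) * theta \<le> measure \<nu> {f. \<exists>t\<in>cube n. f t > 1}"
proof -
  have "real (n + 1) ^ CARD('d) * theta = (\<Sum>s\<in>(cube n :: (int ^ 'd) set). theta)"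
    by (simp add: card_cube)
  also have "\<dots> \<le> (\<Sum>s\<in>cube n. finite_theta ((\<lambda>t. t - s) ` cube n))"
    by (intro sum_mono theta_le_finite_theta) (auto simp: finite_cube image_iff)
  finally show ?thesis by (simp add: measure_exceedance_eq_sum finite_cube)
qed

text \<open>Sites near the boundary contribute at most 1 each. For a site in the inner cube
  \<open>C\<close> the recentred window contains \<open>sym_cube k\<close>, and a larger window has
  a smaller \<open>finite_theta\<close>.\<close>

lemma measure_cube_upper:
  assumes "2 * k \<le> n"
  shows "measure \<nu> {f. \<exists>t\<in>cube n. f t > 1}
     \<le> real (n + 1) ^ CARD('d) - real (n - 2 * k + 1) ^ CARD('d)
       + real (n - 2 * k + 1) ^ CARD('d) * finite_theta (sym_cube k)"
proof -
  define C where "C = {t::int^'d. \<forall>i. int k \<le> t $ i \<and> t $ i \<le> int n - int k}"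
  have card_C: "card C = (n - 2 * k + 1) ^ CARD('d)" and fin_C: "finite C"
    using finite_card_int_box[of "int k" "int n - int k", where ?'d = 'd] assms
    by (simp_all add: C_def nat_diff_distrib nat_add_distrib mult_2 flip: of_nat_diff)
  have C_sub: "C \<subseteq> cube n"
    unfolding C_def cube_def by (smt (verit) Collect_mono of_nat_0_le_iff)
  have "measure \<nu> {f. \<exists>t\<in>cube n. f t > 1} = (\<Sum>s\<in>cube n. finite_theta ((\<lambda>t. t - s) ` cube n))"
    by (simp add: measure_exceedance_eq_sum finite_cube)
  also have "\<dots> = (\<Sum>s\<in>cube n - C. finite_theta ((\<lambda>t. t - s) ` cube n)) + (\<Sum>s\<in>C. finite_theta ((\<lambda>t. t - s) ` cube n))"
    by (rule sum.subset_diff[OF C_sub finite_cube])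
  also have "\<dots> \<le> (\<Sum>s\<in>cube n - C. 1) + (\<Sum>s\<in>C. finite_theta (sym_cube k))"
  proof (intro add_mono sum_mono finite_theta_le_1 finite_theta_antimono finite_imageI finite_cube)
    fix s assume s: "s \<in> C"
    show "sym_cube k \<subseteq> (\<lambda>t. t - s) ` cube n"
    proof
      fix t assume t: "t \<in> sym_cube k"
      have "t + s \<in> cube n"
        unfolding cube_def
      proof (intro CollectI allI)
        fix i
        have "- int k \<le> t $ i \<and> t $ i \<le> int k" "int k \<le> s $ i \<and> s $ i \<le> int n - int k"
          using s t by (auto simp: C_def sym_cube_def)
        then show "0 \<le> (t + s) $ i \<and> (t + s) $ i \<le> int n" by simp
      qed
      then show "t \<in> (\<lambda>t. t - s) ` cube n" by (auto intro!: image_eqI[of _ _ "t + s"])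
    qed
  qed (auto simp: sym_cube_def)
  also have "\<dots> = real (card (cube n - C)) + real (card C) * finite_theta (sym_cube k)"
    by simp
  also have "card (cube n - C) = card (cube n :: (int ^ 'd) set) - card C"
    by (rule card_Diff_subset[OF fin_C C_sub])
  also have "real \<dots> = real (card (cube n :: (int ^ 'd) set)) - real (card C)"
    by (rule of_nat_diff) (rule card_mono[OF finite_cube C_sub])
  finally show ?thesis by (simp add: card_C card_cube)
qed

text \<open>For the upper bound \<open>k\<close> is fixed first, with
  \<open>finite_theta (sym_cube k)\<close> close to \<open>theta\<close>; the boundary layer of
  width \<open>k\<close> then has vanishing density as \<open>n\<close> grows.\<close>

lemma extremal_index_tendsto:
  "(\<lambda>n. measure \<nu> {f. \<exists>t\<in>cube n. f t > 1} / real n ^ CARD('d)) \<longlonglongrightarrow> theta"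
proof -
  let ?a = "\<lambda>n. measure \<nu> {f. \<exists>t\<in>cube n. f t > 1} / real n ^ CARD('d)"
  \<comment> \<open>A side has n+1 points while the normalisation uses n. The value
    \<open>c = 0\<close> serves the full cube and \<open>c = 2 * k\<close> the inner one; the
    subtraction is truncated, so the quotient is rewritten only for n > c.\<close>
  have pow: "(\<lambda>n. real (n - c + 1) ^ CARD('d) / real n ^ CARD('d)) \<longlonglongrightarrow> 1" for c :: nat
  proof -
    have "(\<lambda>n. real (n - c + 1) / real n) \<longlonglongrightarrow> 1"
    proof (rule Lim_transform_eventually)
      show "(\<lambda>n. 1 + (1 - real c) / real n) \<longlonglongrightarrow> 1"
        by (rule tendsto_eq_intros lim_const_over_n refl | simp)+
      show "\<forall>\<^sub>F n in sequentially. 1 + (1 - real c) / real n = real (n - c + 1) / real n"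
        using eventually_ge_at_top[of "Suc c"]
        by eventually_elim (auto simp: field_simps of_nat_diff)
    qed
    from tendsto_power[OF this, of "CARD('d)"] show ?thesis by (simp add: power_divide)
  qed
  show ?thesis
  proof (rule order_tendstoI)
    fix a assume "a < theta"
    have "(\<lambda>n. real (n - 0 + 1) ^ CARD('d) / real n ^ CARD('d) * theta) \<longlonglongrightarrow> 1 * theta"
      by (intro tendsto_mult pow tendsto_const)
    then have "\<forall>\<^sub>F n in sequentially. a < real (n - 0 + 1) ^ CARD('d) / real n ^ CARD('d) * theta"
      using \<open>a < theta\<close> by (intro order_tendstoD) auto
    then show "\<forall>\<^sub>F n in sequentially. a < ?a n"
    proof eventually_elim
      fix n assume "a < real (n - 0 + 1) ^ CARD('d) / real n ^ CARD('d) * theta"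
      also have "\<dots> \<le> ?a n"
        using measure_cube_lower[of n] by (simp add: divide_right_mono)
      finally show "a < ?a n" .
    qed
  next
    fix a assume "theta < a"
    then have "\<forall>\<^sub>F k in sequentially. finite_theta (sym_cube k) < a"
      by (rule order_tendstoD(2)[OF finite_theta_sym_cube_tendsto])
    then obtain k where k: "finite_theta (sym_cube k) < a"
      by (auto simp: eventually_sequentially)
    let ?q = "\<lambda>c n. real (n - c + 1) ^ CARD('d) / real n ^ CARD('d)"
    have "(\<lambda>n. ?q 0 n - ?q (2 * k) n + ?q (2 * k) n * finite_theta (sym_cube k)) \<longlonglongrightarrow> 1 - 1 + 1 * finite_theta (sym_cube k)"
      by (intro tendsto_intros pow)
    then have "\<forall>\<^sub>F n in sequentially. ?q 0 n - ?q (2 * k) n + ?q (2 * k) n * finite_theta (sym_cube k) < a"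
      using k by (intro order_tendstoD) auto
    then show "\<forall>\<^sub>F n in sequentially. ?a n < a"
      using eventually_ge_at_top[of "2 * k"]
    proof eventually_elim
      fix n assume "?q 0 n - ?q (2 * k) n + ?q (2 * k) n * finite_theta (sym_cube k) < a" and n: "2 * k \<le> n"
      moreover have "?a n \<le> ?q 0 n - ?q (2 * k) n + ?q (2 * k) n * finite_theta (sym_cube k)"
        using divide_right_mono[OF measure_cube_upper[OF n], of "real n ^ CARD('d)"]
        by (simp add: add_divide_distrib diff_divide_distrib)
      ultimately show "?a n < a" by simp
    qed
  qed
qed

end

section \<open>Measures on fields determined by finite exceedances\<close>

definition below :: "(int ^ 'd::finite) set \<Rightarrow> (int ^ 'd \<Rightarrow> real) \<Rightarrow> 'd field set" where
  "below T x = {f. \<forall>t\<in>T. f t \<le> x t}"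

lemma sets_PE_eq_sigma_below:
  "sets (PE :: 'd::finite field measure) = sigma_sets UNIV {below T x | T x. finite T}" (is "_ = sigma_sets UNIV ?G")
proof
  have "below T x \<in> sets PE" if "finite T" for T :: "(int ^ 'd) set" and x
    unfolding below_def using that by (intro Collect_in_sets_PE) measurable
  then show "sigma_sets UNIV ?G \<subseteq> sets PE"
    using sets.sigma_sets_subset[of ?G PE] by auto
  have coord: "(\<lambda>f. f t) \<in> borel_measurable (sigma UNIV ?G)" for t :: "int ^ 'd"
  proof (subst borel_measurable_iff_le, intro allI)
    fix a :: real
    have "{f \<in> space (sigma UNIV ?G). f t \<le> a} = below {t} (\<lambda>_. a)"
      by (simp add: below_def space_measure_of_conv)
    also have "\<dots> \<in> sigma_sets UNIV ?G"
      by (rule sigma_sets.Basic) blast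
    finally show "{f \<in> space (sigma UNIV ?G). f t \<le> a} \<in> sets (sigma UNIV ?G)"
      by (simp add: sets_measure_of_conv)
  qed
  have "(\<lambda>f. f) \<in> measurable (sigma UNIV ?G) (PE :: 'd field measure)"
    by (rule measurable_into_PE) (rule coord)
  then show "sets PE \<subseteq> sigma_sets UNIV ?G"
    by (auto simp: measurable_def space_measure_of_conv sets_measure_of_conv)
qed

lemma Int_stable_below: "Int_stable {below T x | T x. finite T}"
proof (rule Int_stableI)
  fix A B :: "'d::finite field set"
  assume "A \<in> {below T x | T x. finite T}" "B \<in> {below T x | T x. finite T}"
  then obtain T x T' x' where AB: "A = below T x" "B = below T' x'" and fin: "finite T" "finite T'"
    by auto
  have "A \<inter> B
      = below (T \<union> T') (\<lambda>t. if t \<in> T \<inter> T' then min (x t) (x' t) else if t \<in> T then x t else x' t)"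
    by (auto simp: AB below_def)
  then show "A \<inter> B \<in> {below T x | T x. finite T}"
    using fin by blast
qed

text \<open>Uniqueness on a generator closed under intersection needs finite measures, but here mass
  may accumulate near the zero field. Restricting to the sets \<open>C n\<close> (some coordinate
  among finitely many exceeds a small positive level) restores finiteness, and these sets exhaust
  the nonzero fields.\<close>

lemma field_measure_eqI:
  fixes \<mu> \<mu>' :: "'d::finite field measure"
  assumes sets: "sets \<mu> = sets PE" "sets \<mu>' = sets PE"
    and nonneg: "AE f in \<mu>. \<forall>t. 0 \<le> f t" "AE f in \<mu>'. \<forall>t. 0 \<le> f t"
    and pos: "AE f in \<mu>. \<exists>t. 0 < f t" "AE f in \<mu>'. \<exists>t. 0 < f t"
    and fin: "\<And>T x. finite T \<Longrightarrow> \<forall>t\<in>T. 0 < x t \<Longrightarrow> emeasure \<mu> (- below T x) < \<top>"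
    and eq: "\<And>T x. finite T \<Longrightarrow> \<forall>t\<in>T. 0 < x t \<Longrightarrow> emeasure \<mu> (- below T x) = emeasure \<mu>' (- below T x)"
  shows "\<mu> = \<mu>'"
proof -
  have below_PE: "below T x \<in> sets PE" if "finite T" for T :: "(int ^ 'd) set" and x
    unfolding below_def using that by (intro Collect_in_sets_PE) measurable
  have Compl_PE: "- A \<in> sets PE" if "A \<in> sets PE" for A :: "'d field set"
    using sets.compl_sets[OF that] by (simp add: Compl_eq_Diff_UNIV)
  define S where "S n = {t::int^'d. to_nat t < n}" for n
  define C where "C n = - below (S n) (\<lambda>_. 1 / real (Suc n))" for n
  have fin_S: "finite (S n)" for n
    unfolding S_def by (rule finite_to_nat_less)
  have C_PE: "C n \<in> sets PE" for n
    unfolding C_def by (intro Compl_PE below_PE fin_S)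
  have C_fin: "emeasure \<mu> (C n) < \<top>" "emeasure \<mu>' (C n) < \<top>" for n
    using fin[OF fin_S, of n "\<lambda>_. 1 / real (Suc n)"] eq[OF fin_S, of n "\<lambda>_. 1 / real (Suc n)"]
    by (simp_all add: C_def)
  have eq_pos: "emeasure \<mu> (C n \<inter> below T x) = emeasure \<mu>' (C n \<inter> below T x)"
    if T: "finite T" and x: "\<forall>t\<in>T. 0 < x t" for n T x
  proof -
    \<comment> \<open>Exceeding the combined level \<open>y\<close> somewhere means violating
      \<open>x\<close> on \<open>T\<close> or lying in \<open>C n\<close>. The set to be measured is
      thus a proper difference of two complements with positive levels.\<close>
    define y where "y t = (if t \<in> T \<inter> S n then min (x t) (1 / real (Suc n))
                           else if t \<in> T then x t else 1 / real (Suc n))" for t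
    have split: "C n \<inter> below T x = - below (T \<union> S n) y - - below T x"
      by (auto simp: C_def below_def y_def split: if_splits)
    have "y t \<le> x t" if "t \<in> T" for t
      using that by (simp add: y_def)
    then have sub: "- below T x \<subseteq> - below (T \<union> S n) y"
      by (auto simp: below_def intro: order_trans)
    have y: "\<forall>t\<in>T \<union> S n. 0 < y t"
      using x by (auto simp: y_def)
    have TS: "finite (T \<union> S n)" using T fin_S by simp
    have "emeasure \<mu> (C n \<inter> below T x) = emeasure \<mu> (- below (T \<union> S n) y) - emeasure \<mu> (- below T x)"
      unfolding split using fin[OF T x] sub
      by (intro emeasure_Diff) (auto simp: sets intro!: Compl_PE below_PE T TS)
    moreover have "emeasure \<mu>' (C n \<inter> below T x) = emeasure \<mu>' (- below (T \<union> S n) y) - emeasure \<mu>' (- below T x)"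
      unfolding split using fin[OF T x] eq[OF T x] sub
      by (intro emeasure_Diff) (auto simp: sets intro!: Compl_PE below_PE T TS)
    ultimately show ?thesis
      using eq[OF T x] eq[OF TS y] by simp
  qed
  have eq_below: "emeasure \<mu> (C n \<inter> below T x) = emeasure \<mu>' (C n \<inter> below T x)"
    if T: "finite T" for n T x
  proof (cases "\<exists>t\<in>T. x t < 0")
    case True
    \<comment> \<open>Almost every field is nonnegative, so a negative level leaves only a null
      set.\<close>
    have null: "emeasure \<kappa> (C n \<inter> below T x) = 0"
      if "sets \<kappa> = sets PE" "AE f in \<kappa>. \<forall>t. 0 \<le> f t" for \<kappa>
    proof -
      have "AE f in \<kappa>. f \<in> C n \<inter> below T x \<longleftrightarrow> f \<in> {}"
        using that(2)
      proof eventually_elim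
        fix f :: "'d field" assume nn: "\<forall>t. 0 \<le> f t"
        from True obtain s where s: "s \<in> T" "x s < 0" by auto
        with nn[rule_format, of s] have "f \<notin> below T x" by (auto simp: below_def intro!: bexI[of _ s])
        then show "f \<in> C n \<inter> below T x \<longleftrightarrow> f \<in> {}" by simp
      qed
      then have "emeasure \<kappa> (C n \<inter> below T x) = emeasure \<kappa> {}"
        by (rule emeasure_eq_AE) (auto simp: that intro!: C_PE below_PE T)
      then show ?thesis by simp
    qed
    show ?thesis
      using null[OF sets(1) nonneg(1)] null[OF sets(2) nonneg(2)] by simp
  next
    case False
    \<comment> \<open>A level may be zero here; positive levels decrease to it, and continuity from
      above applies because \<open>C n\<close> has finite measure.\<close>
    define D where "D m = C n \<inter> below T (\<lambda>t. x t + 1 / real (Suc m))" for m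
    have D_Int: "(\<Inter>m. D m) = C n \<inter> below T x"
    proof -
      have "f t \<le> x t" if "\<And>m. f t \<le> x t + 1 / real (Suc m)" for f :: "'d field" and t
      proof (rule LIMSEQ_le_const)
        show "(\<lambda>m. x t + 1 / real (Suc m)) \<longlonglongrightarrow> x t"
          using tendsto_add[OF tendsto_const LIMSEQ_Suc[OF lim_1_over_n], of "x t"] by simp
      qed (use that in auto)
      moreover have "f t \<le> x t \<Longrightarrow> f t \<le> x t + 1 / real (Suc m)" for f :: "'d field" and t m
        by (smt (verit) of_nat_0_less_iff zero_less_Suc divide_pos_pos)
      ultimately show ?thesis by (auto simp: D_def below_def)
    qed
    have D_dec: "decseq D"
    proof (rule decseq_SucI)
      fix m
      have "1 / real (Suc (Suc m)) \<le> 1 / real (Suc m)" by (simp add: field_simps)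
      then show "D (Suc m) \<subseteq> D m"
        by (force simp: D_def below_def)
    qed
    have D_PE: "range D \<subseteq> sets PE"
      by (auto simp: D_def intro!: C_PE below_PE T)
    have D_fin: "emeasure \<mu> (D m) \<noteq> \<infinity>" "emeasure \<mu>' (D m) \<noteq> \<infinity>" for m
      using emeasure_mono[of "D m" "C n" \<mu>] emeasure_mono[of "D m" "C n" \<mu>'] C_fin[of n]
      by (auto simp: D_def sets C_PE top_unique)
    have "emeasure \<mu> (C n \<inter> below T x) = (INF m. emeasure \<mu> (D m))"
      unfolding D_Int[symmetric] using D_PE D_dec D_fin by (intro INF_emeasure_decseq[symmetric]) (auto simp: sets)
    also have "\<dots> = (INF m. emeasure \<mu>' (D m))"
    proof (intro INF_cong refl)
      fix m
      have "\<forall>t\<in>T. 0 < x t + 1 / real (Suc m)"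
        using False by (auto simp: not_less intro!: add_nonneg_pos)
      then show "emeasure \<mu> (D m) = emeasure \<mu>' (D m)"
        unfolding D_def by (rule eq_pos[OF T])
    qed
    also have "\<dots> = emeasure \<mu>' (C n \<inter> below T x)"
      unfolding D_Int[symmetric] using D_PE D_dec D_fin by (intro INF_emeasure_decseq) (auto simp: sets)
    finally show ?thesis .
  qed
  have "density \<mu> (indicator (C n)) = density \<mu>' (indicator (C n))" for n
  proof (rule measure_eqI_generator_eq[OF Int_stable_below])
    show "sets (density \<mu> (indicator (C n))) = sigma_sets UNIV {below T x | T x. finite T}"
      "sets (density \<mu>' (indicator (C n))) = sigma_sets UNIV {below T x | T x. finite T}"
      by (simp_all add: sets sets_PE_eq_sigma_below)
    fix X :: "'d field set" assume "X \<in> {below T x | T x. finite T}"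
    then obtain T x where "X = below T x" "finite T" by auto
    then show "emeasure (density \<mu> (indicator (C n))) X = emeasure (density \<mu>' (indicator (C n))) X"
      by (simp add: emeasure_restricted sets C_PE below_PE eq_below)
  next
    \<comment> \<open>The empty constraint puts the whole space into the generator, so a constant
      exhausting sequence suffices for the restricted, finite measures.\<close>
    have "UNIV = below {} (\<lambda>_. 0 :: real)" by (simp add: below_def)
    then show "range (\<lambda>_::nat. UNIV) \<subseteq> {below T x :: 'd field set | T x. finite T}"
      by blast
    show "emeasure (density \<mu> (indicator (C n))) UNIV \<noteq> \<infinity>"
      using C_fin[of n] sets.top[of "PE :: 'd field measure"]
      by (simp add: emeasure_restricted sets C_PE)
  qed auto
  then have eq_C: "emeasure \<mu> (C n \<inter> A) = emeasure \<mu>' (C n \<inter> A)" if "A \<in> sets PE" for n A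
    using that emeasure_restricted[of "C n" \<mu> A] emeasure_restricted[of "C n" \<mu>' A]
    by (simp add: sets C_PE)
  have C_inc: "incseq C"
  proof (rule incseq_SucI)
    fix n
    have "1 / real (Suc (Suc n)) \<le> 1 / real (Suc n)" by (simp add: field_simps)
    then show "C n \<subseteq> C (Suc n)"
      unfolding C_def below_def S_def by (fastforce simp: less_Suc_eq)
  qed
  have C_Un: "(\<Union>n. C n) = {f. \<exists>t. 0 < f t}"
  proof (intro equalityI subsetI)
    fix f :: "'d field" assume "f \<in> (\<Union>n. C n)"
    then obtain n t where "1 / real (Suc n) < f t" by (auto simp: C_def below_def not_le)
    then have "0 < f t" by (rule less_trans[rotated]) simp
    then show "f \<in> {f. \<exists>t. 0 < f t}" by auto
  next
    fix f :: "'d field" assume "f \<in> {f. \<exists>t. 0 < f t}"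
    then obtain t where t: "0 < f t" by auto
    then obtain n where n: "1 / real (Suc n) < f t"
      using nat_approx_posE by blast
    \<comment> \<open>Large enough both for the level to drop below \<open>f t\<close> and for
      \<open>t\<close> to belong to the finite index set.\<close>
    define m where "m = max n (Suc (to_nat t))"
    have "1 / real (Suc m) \<le> 1 / real (Suc n)"
      by (simp add: m_def field_simps)
    with n have "1 / real (Suc m) < f t" by (rule le_less_trans[rotated])
    moreover have "t \<in> S m" by (simp add: S_def m_def less_max_iff_disj)
    ultimately have "f \<in> C m"
      by (auto simp: C_def below_def not_le simp del: of_nat_Suc)
    then show "f \<in> (\<Union>n. C n)" by auto
  qed
  have lim: "emeasure \<kappa> A = (SUP n. emeasure \<kappa> (C n \<inter> A))"
    if "sets \<kappa> = sets PE" "AE f in \<kappa>. \<exists>t. 0 < f t" "A \<in> sets PE" for \<kappa> A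
  proof -
    have "(SUP n. emeasure \<kappa> (C n \<inter> A)) = emeasure \<kappa> (\<Union>n. C n \<inter> A)"
      using C_inc by (intro SUP_emeasure_incseq) (auto simp: that incseq_def intro!: C_PE)
    also have "\<dots> = emeasure \<kappa> A"
      using that(2) C_PE that(1,3)
      by (intro emeasure_eq_AE) (auto elim!: eventually_mono simp: C_Un simp flip: UN_extend_simps)
    finally show ?thesis ..
  qed
  show ?thesis
  proof (rule measure_eqI)
    fix A assume "A \<in> sets \<mu>"
    then have "A \<in> sets PE" by (simp add: sets)
    then show "emeasure \<mu> A = emeasure \<mu>' A"
      by (simp add: lim[OF sets(1) pos(1)] lim[OF sets(2) pos(2)] eq_C)
  qed (simp add: sets)
qed

section \<open>The exponent measure of a spectral field\<close>

text \<open>Infinite near 0, with tail mass 1/a beyond a; its restriction to z > 1 is the unit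
  Pareto law.\<close>

definition pareto_intensity :: "real measure" where
  "pareto_intensity = density lborel (\<lambda>z. ennreal (indicator {0<..} z / z\<^sup>2))"

lemma sets_pareto_intensity [measurable_cong, simp]: "sets pareto_intensity = sets borel"
  by (simp add: pareto_intensity_def)

lemma space_pareto_intensity [simp]: "space pareto_intensity = UNIV"
  by (simp add: pareto_intensity_def)

lemma nn_integral_pareto_intensity:
  assumes [measurable]: "F \<in> borel_measurable borel"
  shows "(\<integral>\<^sup>+z. F z \<partial>pareto_intensity) = (\<integral>\<^sup>+z. ennreal (indicator {0<..} z / z\<^sup>2) * F z \<partial>lborel)"
  unfolding pareto_intensity_def by (rule nn_integral_density) measurable

lemma AE_pareto_intensity_iff:
  "(AE z in pareto_intensity. Q z) \<longleftrightarrow> (AE z in lborel. 0 < z \<longrightarrow> Q z)"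
proof -
  have "(AE z in pareto_intensity. Q z) \<longleftrightarrow> (AE z in lborel. 0 < ennreal (indicator {0<..} z / z\<^sup>2) \<longrightarrow> Q z)"
    unfolding pareto_intensity_def by (rule AE_density) measurable
  also have "\<dots> \<longleftrightarrow> (AE z in lborel. 0 < z \<longrightarrow> Q z)"
    by (intro AE_cong) (auto simp: indicator_def)
  finally show ?thesis .
qed

interpretation pareto_intensity: sigma_finite_measure pareto_intensity
  unfolding pareto_intensity_def by (subst sigma_finite_measure.sigma_finite_iff_density_finite[OF sigma_finite_lborel]) auto

lemma emeasure_pareto_intensity_greaterThan:
  assumes "0 < a"
  shows "emeasure pareto_intensity {a<..} = ennreal (1 / a)"
proof -
  have "emeasure pareto_intensity {a<..} = (\<integral>\<^sup>+z. ennreal (indicator {0<..} z / z\<^sup>2) * indicator {a<..} z \<partial>lborel)"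
    using nn_integral_pareto_intensity[of "indicator {a<..}"] by simp
  also have "\<dots> = (\<integral>\<^sup>+z. ennreal (1 / z\<^sup>2) * indicator {a..} z \<partial>lborel)"
    using AE_lborel_singleton[of a]
    by (intro nn_integral_cong_AE, eventually_elim) (use assms in \<open>auto simp: indicator_def\<close>)
  also have "\<dots> = ennreal (0 - (- 1 / a))"
  proof (rule nn_integral_FTC_atLeast)
    show "DERIV (\<lambda>z. - 1 / z) x :> 1 / x\<^sup>2" if "a \<le> x" for x
      using that assms by (auto intro!: derivative_eq_intros simp: power2_eq_square)
    show "((\<lambda>z::real. - 1 / z) \<longlongrightarrow> 0) at_top"
      by (rule tendsto_divide_0[OF tendsto_const filterlim_at_top_imp_at_infinity[OF filterlim_ident]])
  qed auto
  finally show ?thesis by simp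
qed

text \<open>This is how a maximum becomes a mass: the scales that lift \<open>m\<close> above 1 form
  the half-line beyond 1/m, or nothing at all if \<open>m = 0\<close>.\<close>

lemma emeasure_pareto_intensity_threshold:
  assumes "0 \<le> m"
  shows "emeasure pareto_intensity {z. 0 < z \<and> 1 < z * m} = ennreal m"
proof (cases "m = 0")
  case False
  with assms have m: "0 < m" by simp
  then have "{z. 0 < z \<and> 1 < z * m} = {1 / m<..}"
    by (auto simp: field_simps zero_less_mult_iff) (smt (verit) zero_less_mult_iff)
  then show ?thesis
    using emeasure_pareto_intensity_greaterThan[of "1 / m"] m by simp
qed simp

text \<open>In the substitution of z/c for z the line element contributes 1/c and the density
  c^2.\<close>

lemma nn_integral_pareto_intensity_scale:
  assumes [measurable]: "F \<in> borel_measurable borel" and c: "0 < c"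
  shows "(\<integral>\<^sup>+z. F z \<partial>pareto_intensity) = ennreal c * (\<integral>\<^sup>+z. F (z / c) \<partial>pareto_intensity)"
proof -
  have "(\<integral>\<^sup>+z. F z \<partial>pareto_intensity)
      = ennreal (1 / c) * (\<integral>\<^sup>+z. ennreal (indicator {0<..} (z / c) / (z / c)\<^sup>2) * F (z / c) \<partial>lborel)"
    unfolding nn_integral_pareto_intensity[OF assms(1)]
    by (subst nn_integral_real_affine[where c = "1 / c" and t = 0]) (use c in auto)
  also have "\<dots> = ennreal (1 / c) * (\<integral>\<^sup>+z. ennreal (c\<^sup>2) * (ennreal (indicator {0<..} z / z\<^sup>2) * F (z / c)) \<partial>lborel)"
  proof -
    have "ennreal (indicator {0<..} (z / c) / (z / c)\<^sup>2) = ennreal (c\<^sup>2) * ennreal (indicator {0<..} z / z\<^sup>2)" for z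
      using c by (auto simp: indicator_def ennreal_mult[symmetric] power_divide zero_less_divide_iff)
    then show ?thesis by (simp add: mult.assoc)
  qed
  also have "\<dots> = ennreal (1 / c) * ennreal (c\<^sup>2) * (\<integral>\<^sup>+z. F (z / c) \<partial>pareto_intensity)"
    by (simp add: nn_integral_cmult nn_integral_pareto_intensity mult.assoc)
  also have "ennreal (1 / c) * ennreal (c\<^sup>2) = ennreal c"
    using c by (simp add: ennreal_mult[symmetric] power2_eq_square)
  finally show ?thesis .
qed

lemma unit_pareto_distr:
  assumes "prob_space M" "unit_pareto M R"
  shows "distr M borel R = density pareto_intensity (indicator {1<..})"
proof (rule measure_eqI_generator_eq[where E = "range greaterThan" and \<Omega> = UNIV and A = "\<lambda>i. {- real i<..}"])
  interpret prob_space M by fact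
  have R [measurable]: "R \<in> borel_measurable M"
    and tail: "\<And>x. 1 \<le> x \<Longrightarrow> measure M {\<omega>\<in>space M. R \<omega> > x} = 1 / x"
    using assms(2) by (auto simp: unit_pareto_def)
  show "Int_stable (range (greaterThan :: real \<Rightarrow> _))"
  proof (rule Int_stableI)
    fix A B :: "real set" assume "A \<in> range greaterThan" "B \<in> range greaterThan"
    then obtain a b where "A = {a<..}" "B = {b<..}" by auto
    then have "A \<inter> B = {max a b<..}" by auto
    then show "A \<inter> B \<in> range greaterThan" by blast
  qed
  show "sets (distr M borel R) = sigma_sets UNIV (range greaterThan)"
    "sets (density pareto_intensity (indicator {1<..})) = sigma_sets UNIV (range greaterThan)"
    by (simp_all add: borel_Ioi)
  have tail': "emeasure M {\<omega>\<in>space M. R \<omega> > x} = ennreal (1 / max x 1)" for x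
  proof (cases "1 \<le> x")
    case True
    then show ?thesis by (simp add: emeasure_eq_measure tail)
  next
    case False
    \<comment> \<open>Nothing is prescribed for levels below 1, but the tail is monotone and already
      equals 1 at level 1.\<close>
    have "measure M {\<omega>\<in>space M. R \<omega> > 1} \<le> measure M {\<omega>\<in>space M. R \<omega> > x}"
      using False by (intro finite_measure_mono) auto
    then show ?thesis using False tail[of 1] prob_le_1[of "{\<omega>\<in>space M. R \<omega> > x}"]
      by (simp add: emeasure_eq_measure max_def)
  qed
  fix X :: "real set" assume "X \<in> range greaterThan"
  then obtain x where X: "X = {x<..}" by auto
  have "emeasure (distr M borel R) X = emeasure M {\<omega>\<in>space M. R \<omega> > x}"
    by (auto simp: emeasure_distr X intro!: arg_cong[where f = "emeasure M"])
  also have "\<dots> = emeasure pareto_intensity {max x 1<..}"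
    by (simp add: tail' emeasure_pareto_intensity_greaterThan)
  also have "{max x 1<..} = {1<..} \<inter> X" by (auto simp: X)
  also have "emeasure pareto_intensity ({1<..} \<inter> X) = emeasure (density pareto_intensity (indicator {1<..})) X"
    by (rule emeasure_restricted[symmetric]) (auto simp: X)
  finally show "emeasure (distr M borel R) X = emeasure (density pareto_intensity (indicator {1<..})) X" .
next
  interpret prob_space M by fact
  show "emeasure (distr M borel R) {- real i<..} \<noteq> \<infinity>" for i
    using assms(2) by (simp add: unit_pareto_def emeasure_distr)
  show "(\<Union>i. {- real i<..}) = UNIV"
  proof (intro equalityI subsetI UNIV_I)
    fix x :: real
    obtain n :: nat where "- x < real n" using reals_Archimedean2 by auto
    then show "x \<in> (\<Union>i. {- real i<..})" by (auto intro!: exI[of _ n])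
  qed
qed auto

section \<open>The exponent measure and its behaviour under scaling\<close>

definition exponent_measure :: "'a measure \<Rightarrow> ('a \<Rightarrow> 'd::finite field) \<Rightarrow> 'd field measure" where
  "exponent_measure M Z = distr (M \<Otimes>\<^sub>M pareto_intensity) PE (\<lambda>(\<omega>, z) t. z * Z \<omega> t)"

lemma sets_exponent_measure [simp, measurable_cong]: "sets (exponent_measure M Z) = sets PE"
  by (simp add: exponent_measure_def)

lemma space_exponent_measure [simp]: "space (exponent_measure M Z) = UNIV"
  by (simp add: exponent_measure_def)

lemma measurable_scaled_field:
  assumes "Z \<in> measurable N PE"
  shows "(\<lambda>(\<omega>, z) t. z * Z \<omega> t) \<in> measurable (N \<Otimes>\<^sub>M pareto_intensity) PE"
proof (rule measurable_into_PE)
  fix t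
  have [measurable]: "(\<lambda>\<omega>. Z \<omega> t) \<in> borel_measurable N"
    by (rule measurable_field_coord[OF assms])
  show "(\<lambda>p. (case p of (\<omega>, z) \<Rightarrow> \<lambda>t. z * Z \<omega> t) t) \<in> borel_measurable (N \<Otimes>\<^sub>M pareto_intensity)"
    by (simp add: case_prod_beta)
qed

lemma measurable_scale_field: "(\<lambda>z t. z * f t) \<in> measurable borel (PE :: 'd::finite field measure)"
  by (rule measurable_into_PE) measurable

lemma nn_integral_exponent_measure:
  assumes "Z \<in> measurable M PE" and [measurable]: "F \<in> borel_measurable PE"
  shows "(\<integral>\<^sup>+f. F f \<partial>exponent_measure M Z) = (\<integral>\<^sup>+\<omega>. \<integral>\<^sup>+z. F (\<lambda>t. z * Z \<omega> t) \<partial>pareto_intensity \<partial>M)"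
proof -
  note [measurable] = measurable_scaled_field[OF assms(1)]
  have "(\<integral>\<^sup>+f. F f \<partial>exponent_measure M Z)
      = (\<integral>\<^sup>+p. F ((\<lambda>(\<omega>, z) t. z * Z \<omega> t) p) \<partial>(M \<Otimes>\<^sub>M pareto_intensity))"
    unfolding exponent_measure_def by (rule nn_integral_distr) measurable
  also have "\<dots> = (\<integral>\<^sup>+\<omega>. \<integral>\<^sup>+z. F ((\<lambda>(\<omega>, z) t. z * Z \<omega> t) (\<omega>, z)) \<partial>pareto_intensity \<partial>M)"
    by (rule pareto_intensity.nn_integral_fst[symmetric]) measurable
  finally show ?thesis by simp
qed

lemma AE_exponent_measureI:
  assumes "Z \<in> measurable M PE" and [measurable]: "Measurable.pred PE Q"
    and "AE \<omega> in M. AE z in pareto_intensity. Q (\<lambda>t. z * Z \<omega> t)"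
  shows "AE f in exponent_measure M Z. Q f"
proof -
  have N: "{f. \<not> Q f} \<in> sets PE"
    by (rule Collect_in_sets_PE) measurable
  have "emeasure (exponent_measure M Z) {f. \<not> Q f} = (\<integral>\<^sup>+f. indicator {f. \<not> Q f} f \<partial>exponent_measure M Z)"
    using N by simp
  also have "\<dots> = (\<integral>\<^sup>+\<omega>. \<integral>\<^sup>+z. indicator {f. \<not> Q f} (\<lambda>t. z * Z \<omega> t) \<partial>pareto_intensity \<partial>M)"
    using N by (intro nn_integral_exponent_measure assms(1)) auto
  also have "\<dots> = (\<integral>\<^sup>+\<omega>. 0 \<partial>M)"
  proof (rule nn_integral_cong_AE, use assms(3) in eventually_elim)
    fix \<omega> assume "AE z in pareto_intensity. Q (\<lambda>t. z * Z \<omega> t)"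
    then have "(\<integral>\<^sup>+z. indicator {f. \<not> Q f} (\<lambda>t. z * Z \<omega> t) \<partial>pareto_intensity) = (\<integral>\<^sup>+z. 0 \<partial>pareto_intensity)"
      by (intro nn_integral_cong_AE) (auto elim!: eventually_mono)
    then show "(\<integral>\<^sup>+z. indicator {f. \<not> Q f} (\<lambda>t. z * Z \<omega> t) \<partial>pareto_intensity) = 0" by simp
  qed
  finally show ?thesis
    using N by (intro AE_I[of _ _ "{f. \<not> Q f}"]) auto
qed

lemma Mx_scale: "0 \<le> c \<Longrightarrow> Mx (\<lambda>t. c * f t) = ennreal c * Mx f"
  unfolding Mx_def by (simp add: ennreal_mult' SUP_mult_left_ennreal)

lemma Ssum_scale: "0 \<le> c \<Longrightarrow> Ssum (\<lambda>t. c * f t) = ennreal c * Ssum f"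
  unfolding Ssum_eq_nn_integral by (simp add: ennreal_mult' nn_integral_cmult)

lemma Ssum_scale_finite_iff: "0 < c \<Longrightarrow> Ssum (\<lambda>t. c * f t) < \<top> \<longleftrightarrow> Ssum f < \<top>"
  by (auto simp: Ssum_scale ennreal_mult_less_top ennreal_mult_top)

lemma ratio_enn_scale:
  assumes "0 < c"
  shows "ratio_enn (ennreal c * a) (ennreal c * b) = ratio_enn a b"
  using assms by (auto simp: ratio_enn_def enn2real_mult ennreal_mult_eq_top_iff)

section \<open>Stationarity of the max-stable field as invariance of the exponent measure\<close>

locale max_stable_spectral = prob_space M for M :: "'a measure" +
  fixes X Z :: "'a \<Rightarrow> 'd::finite field"
  assumes stationary: "stationary M X" and spectral: "spectral_rf M X Z"
begin

lemma measurable_Z: "Z \<in> measurable M PE"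
  using spectral by (simp add: spectral_rf_def)

lemma measurable_Z_coord [measurable]: "(\<lambda>\<omega>. Z \<omega> t) \<in> borel_measurable M"
  by (rule measurable_field_coord[OF measurable_Z])

lemma Z_nonneg: "\<omega> \<in> space M \<Longrightarrow> 0 \<le> Z \<omega> t"
  using spectral by (simp add: spectral_rf_def)

lemma integrable_Z: "integrable M (\<lambda>\<omega>. Z \<omega> t)" and expectation_Z: "expectation (\<lambda>\<omega>. Z \<omega> t) = 1"
  using spectral by (simp_all add: spectral_rf_def)

lemma nn_integral_Z: "(\<integral>\<^sup>+\<omega>. ennreal (Z \<omega> t) \<partial>M) = 1"
  using nn_integral_eq_integral[OF integrable_Z] by (simp add: expectation_Z Z_nonneg)

definition \<nu> :: "'d field measure" where
  "\<nu> = exponent_measure M Z"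

lemma sets_nu [simp, measurable_cong]: "sets \<nu> = sets PE"
  by (simp add: \<nu>_def)

lemma below_in_sets: "finite T \<Longrightarrow> below T x \<in> sets (PE :: 'd field measure)"
  unfolding below_def by (rule Collect_in_sets_PE) measurable

lemma Compl_below_in_sets: "finite T \<Longrightarrow> - below T x \<in> sets (PE :: 'd field measure)"
  using sets.compl_sets[OF below_in_sets] by (simp add: Compl_eq_Diff_UNIV)

lemma integrable_Max:
  assumes "finite T" "T \<noteq> {}" "\<forall>t\<in>T. 0 < x t"
  shows "integrable M (\<lambda>\<omega>. Max ((\<lambda>t. Z \<omega> t / x t) ` T))"
proof (rule Bochner_Integration.integrable_bound)
  show "integrable M (\<lambda>\<omega>. \<Sum>t\<in>T. Z \<omega> t / x t)"
    by (intro Bochner_Integration.integrable_sum integrable_divide integrable_Z)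
  show "(\<lambda>\<omega>. Max ((\<lambda>t. Z \<omega> t / x t) ` T)) \<in> borel_measurable M"
    using assms(1) by (intro borel_measurable_Max) measurable
  show "AE \<omega> in M. norm (Max ((\<lambda>t. Z \<omega> t / x t) ` T)) \<le> norm (\<Sum>t\<in>T. Z \<omega> t / x t)"
  proof (rule AE_I2)
    fix \<omega> assume \<omega>: "\<omega> \<in> space M"
    have nn: "0 \<le> Z \<omega> t / x t" if "t \<in> T" for t
      using Z_nonneg[OF \<omega>, of t] assms(3) that by (auto intro!: divide_nonneg_pos)
    have "0 \<le> Max ((\<lambda>t. Z \<omega> t / x t) ` T)"
      using assms nn by (auto simp: Max_ge_iff)
    moreover have "Max ((\<lambda>t. Z \<omega> t / x t) ` T) \<le> (\<Sum>t\<in>T. Z \<omega> t / x t)"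
      using assms(1,2) nn by (auto intro!: member_le_sum)
    ultimately show "norm (Max ((\<lambda>t. Z \<omega> t / x t) ` T)) \<le> norm (\<Sum>t\<in>T. Z \<omega> t / x t)"
      by simp
  qed
qed

lemma Max_nonneg:
  assumes "finite T" "T \<noteq> {}" "\<forall>t\<in>T. 0 < x t" "\<omega> \<in> space M"
  shows "0 \<le> Max ((\<lambda>t. Z \<omega> t / x t) ` T)"
  using assms Z_nonneg[OF assms(4)] by (auto simp: Max_ge_iff intro!: divide_nonneg_pos)

text \<open>For fixed \<open>\<omega>\<close>, the field z Z(\<omega>) leaves
  \<open>below T x\<close> exactly when z times the maximum of Z/x over \<open>T\<close> exceeds 1,
  and the set of such scales has mass equal to that maximum.\<close>

lemma emeasure_nu_Compl_below:
  assumes "finite T" "T \<noteq> {}" "\<forall>t\<in>T. 0 < x t"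
  shows "emeasure \<nu> (- below T x) = ennreal (\<integral>\<omega>. Max ((\<lambda>t. Z \<omega> t / x t) ` T) \<partial>M)"
proof -
  have "emeasure \<nu> (- below T x) = (\<integral>\<^sup>+f. indicator (- below T x) f \<partial>\<nu>)"
    using Compl_below_in_sets[OF assms(1)] by simp
  also have "\<dots> = (\<integral>\<^sup>+\<omega>. \<integral>\<^sup>+z. indicator (- below T x) (\<lambda>t. z * Z \<omega> t) \<partial>pareto_intensity \<partial>M)"
    unfolding \<nu>_def using Compl_below_in_sets[OF assms(1)]
    by (intro nn_integral_exponent_measure measurable_Z) auto
  also have "\<dots> = (\<integral>\<^sup>+\<omega>. ennreal (Max ((\<lambda>t. Z \<omega> t / x t) ` T)) \<partial>M)"
  proof (rule nn_integral_cong)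
    fix \<omega> assume \<omega>: "\<omega> \<in> space M"
    let ?m = "Max ((\<lambda>t. Z \<omega> t / x t) ` T)"
    have "(\<integral>\<^sup>+z. indicator (- below T x) (\<lambda>t. z * Z \<omega> t) \<partial>pareto_intensity)
        = (\<integral>\<^sup>+z. indicator {z. 0 < z \<and> 1 < z * ?m} z \<partial>pareto_intensity)"
    proof (rule nn_integral_cong_AE, unfold AE_pareto_intensity_iff, intro AE_I2 impI)
      fix z :: real assume z: "0 < z"
      have "1 < z * ?m \<longleftrightarrow> 1 / z < ?m"
        using z by (simp add: field_simps)
      also have "\<dots> \<longleftrightarrow> (\<exists>t\<in>T. 1 / z < Z \<omega> t / x t)"
        using assms(1,2) by (simp add: Max_gr_iff)
      also have "\<dots> \<longleftrightarrow> (\<exists>t\<in>T. x t < z * Z \<omega> t)"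
        using z assms(3) by (intro bex_cong refl) (auto simp: field_simps)
      finally show "indicator (- below T x) (\<lambda>t. z * Z \<omega> t) = (indicator {z. 0 < z \<and> 1 < z * ?m} z :: ennreal)"
        using z by (auto simp: indicator_def below_def not_le)
    qed
    also have "\<dots> = emeasure pareto_intensity {z. 0 < z \<and> 1 < z * ?m}"
      by (rule nn_integral_indicator) simp
    also have "\<dots> = ennreal ?m"
      by (rule emeasure_pareto_intensity_threshold[OF Max_nonneg[OF assms \<omega>]])
    finally show "(\<integral>\<^sup>+z. indicator (- below T x) (\<lambda>t. z * Z \<omega> t) \<partial>pareto_intensity) = ennreal ?m" .
  qed
  also have "\<dots> = ennreal (\<integral>\<omega>. Max ((\<lambda>t. Z \<omega> t / x t) ` T) \<partial>M)"
    using Max_nonneg[OF assms] by (intro nn_integral_eq_integral integrable_Max assms) auto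
  finally show ?thesis .
qed

lemma measure_X_below:
  assumes "finite T" "T \<noteq> {}" "\<forall>t\<in>T. 0 < x t"
  shows "measure M {\<omega>\<in>space M. X \<omega> \<in> below T x} = exp (- (\<integral>\<omega>. Max ((\<lambda>t. Z \<omega> t / x t) ` T) \<partial>M))"
  using spectral assms by (simp add: spectral_rf_def below_def)

lemma shift_in_below_iff:
  "shift h f \<in> below T x \<longleftrightarrow> f \<in> below ((\<lambda>t. t - h) ` T) (\<lambda>t. x (t + h))"
  by (simp add: below_def shift_def)

text \<open>Both sides are minus the logarithm of the probability of one event for \<open>X\<close>
  and for its shift. A shift that lies in an orthant means that the original field lies in the
  recentred orthant, and \<open>exp\<close> is injective.\<close>

lemma expectation_Max_translate:
  assumes "finite T" "T \<noteq> {}" "\<forall>t\<in>T. 0 < x t"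
  shows "(\<integral>\<omega>. Max ((\<lambda>t. Z \<omega> t / x (t + h)) ` (\<lambda>t. t - h) ` T) \<partial>M) = (\<integral>\<omega>. Max ((\<lambda>t. Z \<omega> t / x t) ` T) \<partial>M)"
proof -
  have X [measurable]: "X \<in> measurable M PE" and X_shift: "distr M PE (\<lambda>\<omega>. shift h (X \<omega>)) = distr M PE X"
    using stationary by (simp_all add: stationary_def)
  have "measure (distr M PE (\<lambda>\<omega>. shift h (X \<omega>))) (below T x) = measure M {\<omega>\<in>space M. shift h (X \<omega>) \<in> below T x}"
    by (subst measure_distr) (auto simp: below_in_sets assms(1) intro!: arg_cong[where f = "measure M"])
  moreover have "measure (distr M PE X) (below T x) = measure M {\<omega>\<in>space M. X \<omega> \<in> below T x}"
    by (subst measure_distr) (auto simp: below_in_sets assms(1) intro!: arg_cong[where f = "measure M"])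
  ultimately have "measure M {\<omega>\<in>space M. X \<omega> \<in> below ((\<lambda>t. t - h) ` T) (\<lambda>t. x (t + h))}
      = measure M {\<omega>\<in>space M. X \<omega> \<in> below T x}"
    by (simp add: X_shift shift_in_below_iff)
  then show ?thesis
    using assms by (simp add: measure_X_below)
qed

lemma AE_nu_nonneg: "AE f in \<nu>. \<forall>t. 0 \<le> f t"
  unfolding \<nu>_def
  by (rule AE_exponent_measureI[OF measurable_Z])
     (auto simp: AE_pareto_intensity_iff intro!: AE_I2 mult_nonneg_nonneg Z_nonneg)

lemma AE_nu_positive: "AE f in \<nu>. \<exists>t. 0 < f t"
proof -
  have "AE \<omega> in M. \<exists>t. 0 < Z \<omega> t"
    using spectral by (simp add: spectral_rf_def)
  then have "AE \<omega> in M. AE z in pareto_intensity. \<exists>t. 0 < z * Z \<omega> t"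
    by eventually_elim (auto simp: AE_pareto_intensity_iff zero_less_mult_iff)
  then show ?thesis
    unfolding \<nu>_def by (intro AE_exponent_measureI[OF measurable_Z]) auto
qed

lemma distr_nu_shift: "distr \<nu> PE (shift h) = \<nu>"
proof (rule field_measure_eqI[symmetric])
  have nn: "{f::'d field. \<forall>t. 0 \<le> f t} \<in> sets PE" and pos: "{f::'d field. \<exists>t. 0 < f t} \<in> sets PE"
    by (auto intro!: Collect_in_sets_PE)
  show "AE f in distr \<nu> PE (shift h). \<forall>t. 0 \<le> f t"
    using AE_nu_nonneg nn by (subst AE_distr_iff) (auto elim!: eventually_mono simp: shift_def)
  have "(\<exists>t. 0 < f t) \<Longrightarrow> (\<exists>t. 0 < f (t - h))" for f :: "'d field"
    by (metis add_diff_cancel_right')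
  then show "AE f in distr \<nu> PE (shift h). \<exists>t. 0 < f t"
    using AE_nu_positive pos by (subst AE_distr_iff) (auto elim!: eventually_mono simp: shift_def)
  fix T :: "(int ^ 'd) set" and x :: "int ^ 'd \<Rightarrow> real"
  assume T: "finite T" and x: "\<forall>t\<in>T. 0 < x t"
  show "emeasure \<nu> (- below T x) < \<top>"
    using emeasure_nu_Compl_below[OF T _ x] by (cases "T = {}") (auto simp: below_def)
  have "emeasure (distr \<nu> PE (shift h)) (- below T x) = emeasure \<nu> (- below ((\<lambda>t. t - h) ` T) (\<lambda>t. x (t + h)))"
    using Compl_below_in_sets[OF T, of x]
    by (subst emeasure_distr) (auto simp: shift_in_below_iff \<nu>_def intro!: arg_cong[where f = "emeasure (exponent_measure M Z)"])
  also have "\<dots> = emeasure \<nu> (- below T x)"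
  \<comment> \<open>For empty \<open>T\<close> the maximum has no meaning, but both complements are
    empty.\<close>
  proof (cases "T = {}")
    case False
    then show ?thesis
      using T x by (simp add: emeasure_nu_Compl_below expectation_Max_translate)
  qed (simp add: below_def)
  finally show "emeasure \<nu> (- below T x) = emeasure (distr \<nu> PE (shift h)) (- below T x)" ..
qed (use AE_nu_nonneg AE_nu_positive in auto)

sublocale tail_measure \<nu>
proof
  show "sets \<nu> = sets PE" by simp
  show "distr \<nu> PE (shift h) = \<nu>" for h by (rule distr_nu_shift)
  show "AE f in \<nu>. \<forall>t. 0 \<le> f t" by (rule AE_nu_nonneg)
  show "AE f in \<nu>. f 0 \<noteq> 1"
    unfolding \<nu>_def
  proof (rule AE_exponent_measureI[OF measurable_Z])
    \<comment> \<open>For fixed \<open>\<omega>\<close> at most one scale, 1/Z(0), hits level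
      1.\<close>
    have "AE z in lborel. 0 < z \<longrightarrow> z * Z \<omega> 0 \<noteq> 1" for \<omega>
      using AE_lborel_singleton[of "1 / Z \<omega> 0"]
      by eventually_elim (auto simp: eq_divide_eq split: if_splits)
    then show "AE \<omega> in M. AE z in pareto_intensity. z * Z \<omega> 0 \<noteq> 1"
      by (simp add: AE_pareto_intensity_iff)
  qed measurable
  have "{f :: 'd field. 1 < f 0} = - below {0} (\<lambda>_. 1)"
    by (auto simp: below_def)
  then show "emeasure \<nu> {f. 1 < f 0} = 1"
    by (simp add: emeasure_nu_Compl_below expectation_Z)
  fix c :: nat
  let ?B = "{f :: 'd field. 1 < Mx f \<and> Mx f \<le> of_nat c}"
  have B: "?B \<in> sets PE" by (rule Collect_in_sets_PE) measurable
  have "(\<integral>\<^sup>+f. ennreal (f 0) * indicator ?B f \<partial>\<nu>)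
      = (\<integral>\<^sup>+\<omega>. \<integral>\<^sup>+z. ennreal (z * Z \<omega> 0) * indicator ?B (\<lambda>t. z * Z \<omega> t) \<partial>pareto_intensity \<partial>M)"
    unfolding \<nu>_def using B by (intro nn_integral_exponent_measure measurable_Z) measurable
  also have "\<dots> \<le> (\<integral>\<^sup>+\<omega>. of_nat c * ennreal (Z \<omega> 0) \<partial>M)"
  proof (rule nn_integral_mono)
    fix \<omega> assume \<omega>: "\<omega> \<in> space M"
    show "(\<integral>\<^sup>+z. ennreal (z * Z \<omega> 0) * indicator ?B (\<lambda>t. z * Z \<omega> t) \<partial>pareto_intensity) \<le> of_nat c * ennreal (Z \<omega> 0)"
    \<comment> \<open>In the degenerate cases no positive scale puts the maximum into the interval
      (1, c].\<close>
    proof (cases "Mx (Z \<omega>) = 0 \<or> Mx (Z \<omega>) = \<top>")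
      case True
      have "(\<integral>\<^sup>+z. ennreal (z * Z \<omega> 0) * indicator ?B (\<lambda>t. z * Z \<omega> t) \<partial>pareto_intensity) = (\<integral>\<^sup>+z. 0 \<partial>pareto_intensity)"
        by (rule nn_integral_cong_AE, unfold AE_pareto_intensity_iff, intro AE_I2 impI)
           (use True in \<open>auto simp: indicator_def Mx_scale ennreal_mult_top top_unique\<close>)
      then show ?thesis by simp
    next
      case False
      define m where "m = enn2real (Mx (Z \<omega>))"
      have Mx: "Mx (Z \<omega>) = ennreal m" and m: "0 < m"
        using False by (auto simp: m_def less_top enn2real_positive_iff zero_less_iff_neq_zero)
      \<comment> \<open>The cap gives z \<le> c/m, and the scales with z m > 1 have mass m, so m
        cancels. The exact value would be Z(0) log c (for c \<ge> 1); the cruder c Z(0)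
        suffices.\<close>
      have "(\<integral>\<^sup>+z. ennreal (z * Z \<omega> 0) * indicator ?B (\<lambda>t. z * Z \<omega> t) \<partial>pareto_intensity)
          \<le> (\<integral>\<^sup>+z. ennreal (real c / m * Z \<omega> 0) * indicator {z. 0 < z \<and> 1 < z * m} z \<partial>pareto_intensity)"
      proof (rule nn_integral_mono_AE, unfold AE_pareto_intensity_iff, intro AE_I2 impI)
        fix z :: real assume z: "0 < z"
        have "Mx (\<lambda>t. z * Z \<omega> t) = ennreal (z * m)"
          using z m by (simp add: Mx_scale Mx ennreal_mult)
        moreover have "z * Z \<omega> 0 \<le> real c / m * Z \<omega> 0" if "z * m \<le> real c"
          using that m Z_nonneg[OF \<omega>, of 0] by (intro mult_right_mono) (auto simp: field_simps)
        ultimately show "ennreal (z * Z \<omega> 0) * indicator ?B (\<lambda>t. z * Z \<omega> t)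
            \<le> ennreal (real c / m * Z \<omega> 0) * indicator {z. 0 < z \<and> 1 < z * m} z"
          using z by (auto simp: indicator_def ennreal_of_nat_eq_real_of_nat intro: ennreal_leI)
      qed
      also have "\<dots> = ennreal (real c / m * Z \<omega> 0) * ennreal m"
        using emeasure_pareto_intensity_threshold[of m] m by (subst nn_integral_cmult_indicator) auto
      also have "\<dots> = of_nat c * ennreal (Z \<omega> 0)"
        using m Z_nonneg[OF \<omega>, of 0] by (simp add: ennreal_mult[symmetric] ennreal_of_nat_eq_real_of_nat)
      finally show ?thesis .
    qed
  qed
  also have "\<dots> = of_nat c"
    by (simp add: nn_integral_cmult nn_integral_Z)
  also have "\<dots> < \<top>" by (simp add: less_top[symmetric])
  finally show "(\<integral>\<^sup>+f. ennreal (f 0) * indicator ?B f \<partial>\<nu>) < \<top>" .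
qed

section \<open>The extremal index and the ratio expectation in terms of the spectral field\<close>

lemma ext_seq_eq: "ext_seq M Z n = measure \<nu> {f. \<exists>t\<in>cube n. f t > 1} / real n ^ CARD('d)"
proof -
  have "cube n \<noteq> ({} :: (int ^ 'd) set)"
    using card_cube[of n] by fastforce
  moreover have "{f. \<exists>t\<in>cube n. f t > 1} = - below (cube n) (\<lambda>_::int^'d. 1)"
    by (auto simp: below_def not_le)
  ultimately show ?thesis
    using Max_nonneg[OF finite_cube[of n], of "\<lambda>_. 1"]
    by (simp add: ext_seq_def measure_def emeasure_nu_Compl_below finite_cube integral_nonneg_AE)
qed

lemma ext_seq_tendsto: "ext_seq M Z \<longlonglongrightarrow> theta"
  using extremal_index_tendsto by (simp add: ext_seq_eq[abs_def])

text \<open>The fraction f(0)/S(f) does not change with the scale z; only the event 1 < z max Z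
  does, and it integrates to max Z.\<close>

lemma nn_integral_Z_ratio: "(\<integral>\<^sup>+\<omega>. ennreal (Z \<omega> 0 * ratio_enn (Mx (Z \<omega>)) (Ssum (Z \<omega>))) \<partial>M) = ennreal theta"
proof -
  let ?B = "{f :: 'd field. 1 < Mx f \<and> Ssum f < \<top>}"
  have B: "?B \<in> sets PE" by (rule Collect_in_sets_PE) measurable
  have "ennreal theta = (\<integral>\<^sup>+f. ennreal (f 0) / Ssum f * indicator ?B f \<partial>\<nu>)"
    by (rule nn_integral_mass_fraction_eq_theta[symmetric])
  also have "\<dots> = (\<integral>\<^sup>+\<omega>. \<integral>\<^sup>+z. ennreal (z * Z \<omega> 0) / Ssum (\<lambda>t. z * Z \<omega> t) * indicator ?B (\<lambda>t. z * Z \<omega> t) \<partial>pareto_intensity \<partial>M)"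
    unfolding \<nu>_def using B by (intro nn_integral_exponent_measure measurable_Z) measurable
  also have "\<dots> = (\<integral>\<^sup>+\<omega>. ennreal (Z \<omega> 0 * ratio_enn (Mx (Z \<omega>)) (Ssum (Z \<omega>))) \<partial>M)"
  proof (rule nn_integral_cong)
    fix \<omega> assume \<omega>: "\<omega> \<in> space M"
    let ?F = "\<lambda>z. ennreal (z * Z \<omega> 0) / Ssum (\<lambda>t. z * Z \<omega> t) * indicator ?B (\<lambda>t. z * Z \<omega> t)"
    show "(\<integral>\<^sup>+z. ?F z \<partial>pareto_intensity) = ennreal (Z \<omega> 0 * ratio_enn (Mx (Z \<omega>)) (Ssum (Z \<omega>)))"
    proof (cases "Ssum (Z \<omega>) = 0 \<or> Ssum (Z \<omega>) = \<top>")
      case True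
      have "(\<integral>\<^sup>+z. ?F z \<partial>pareto_intensity) = (\<integral>\<^sup>+z. 0 \<partial>pareto_intensity)"
      proof (rule nn_integral_cong_AE, unfold AE_pareto_intensity_iff, intro AE_I2 impI)
        fix z :: real assume z: "0 < z"
        show "?F z = 0"
          \<comment> \<open>A zero sum forces a zero maximum and an infinite sum stays infinite, so
            the indicator fails either way.\<close>
          using True z Mx_le_Ssum[of "\<lambda>t. z * Z \<omega> t"]
          by (auto simp: indicator_def Ssum_scale ennreal_mult_top)
      qed
      then show ?thesis using True by (auto simp: ratio_enn_def)
    next
      case False
      define m where "m = enn2real (Mx (Z \<omega>))"
      define s where "s = enn2real (Ssum (Z \<omega>))"
      have S: "Ssum (Z \<omega>) = ennreal s" and s: "0 < s"
        using False by (auto simp: s_def less_top enn2real_positive_iff zero_less_iff_neq_zero)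
      have Mx: "Mx (Z \<omega>) = ennreal m" and m: "0 \<le> m"
        using False Mx_le_Ssum[of "Z \<omega>"] by (auto simp: m_def less_top)
      have "(\<integral>\<^sup>+z. ?F z \<partial>pareto_intensity)
          = (\<integral>\<^sup>+z. ennreal (Z \<omega> 0 / s) * indicator {z. 0 < z \<and> 1 < z * m} z \<partial>pareto_intensity)"
      proof (rule nn_integral_cong_AE, unfold AE_pareto_intensity_iff, intro AE_I2 impI)
        fix z :: real assume z: "0 < z"
        have "Mx (\<lambda>t. z * Z \<omega> t) = ennreal (z * m)" "Ssum (\<lambda>t. z * Z \<omega> t) = ennreal (z * s)"
          using z m s by (simp_all add: Mx_scale Mx Ssum_scale S ennreal_mult)
        moreover have "ennreal (z * Z \<omega> 0) / ennreal (z * s) = ennreal (Z \<omega> 0 / s)"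
          using z s Z_nonneg[OF \<omega>, of 0] by (simp add: divide_ennreal)
        ultimately show "?F z = ennreal (Z \<omega> 0 / s) * indicator {z. 0 < z \<and> 1 < z * m} z"
          using z by (auto simp: indicator_def)
      qed
      also have "\<dots> = ennreal (Z \<omega> 0 / s) * ennreal m"
        using emeasure_pareto_intensity_threshold[OF m] by (subst nn_integral_cmult_indicator) auto
      also have "\<dots> = ennreal (Z \<omega> 0 * ratio_enn (Mx (Z \<omega>)) (Ssum (Z \<omega>)))"
        using s m Z_nonneg[OF \<omega>, of 0] by (simp add: ennreal_mult[symmetric] ratio_enn_def Mx S)
      finally show ?thesis .
    qed
  qed
  finally show ?thesis ..
qed

lemma expectation_Z_ratio: "(\<integral>\<omega>. Z \<omega> 0 * ratio_enn (Mx (Z \<omega>)) (Ssum (Z \<omega>)) \<partial>M) = theta"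
proof -
  note [measurable] = measurable_Z
  show ?thesis
    by (subst integral_eq_nn_integral)
       (auto simp: nn_integral_Z_ratio theta_nonneg intro!: AE_I2 mult_nonneg_nonneg Z_nonneg ratio_enn_nonneg)
qed

end

section \<open>First exceedance and first maximum\<close>

text \<open>A finite nonempty set has a least element, unique by antisymmetry, so the definite
  description in \<open>ord_min\<close> denotes. The equivalence removes the description from all
  later arguments.\<close>

lemma ord_min_eq_iff:
  assumes r: "linear_order r" and A: "finite A" "A \<noteq> {}"
  shows "ord_min r A = j \<longleftrightarrow> j \<in> A \<and> (\<forall>i\<in>A. (j, i) \<in> r)"
proof -
  have refl: "(i, i) \<in> r" for i
    using r unfolding linear_order_on_def partial_order_on_def preorder_on_def by (blast intro: refl_onD)
  have tot: "(i, k) \<in> r \<or> (k, i) \<in> r"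
    and trans: "(i, k) \<in> r \<Longrightarrow> (k, l) \<in> r \<Longrightarrow> (i, l) \<in> r"
    and anti: "(i, k) \<in> r \<Longrightarrow> (k, i) \<in> r \<Longrightarrow> i = k" for i k l
  proof -
    show "(i, k) \<in> r \<or> (k, i) \<in> r"
      using r refl by (cases "i = k") (auto simp: linear_order_on_def total_on_def)
    show "(i, k) \<in> r \<Longrightarrow> (k, l) \<in> r \<Longrightarrow> (i, l) \<in> r"
      using r unfolding linear_order_on_def partial_order_on_def preorder_on_def by (blast dest: transD)
    show "(i, k) \<in> r \<Longrightarrow> (k, i) \<in> r \<Longrightarrow> i = k"
      using r unfolding linear_order_on_def partial_order_on_def by (blast dest: antisymD)
  qed
  have "\<exists>j\<in>A. \<forall>i\<in>A. (j, i) \<in> r"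
    using A
  proof (induction rule: finite_ne_induct)
    case (singleton x)
    then show ?case using refl by simp
  next
    case (insert x F)
    then obtain m where "m \<in> F" "\<forall>i\<in>F. (m, i) \<in> r" by auto
    with tot[of x m] show ?case
      by (metis insert_iff refl trans)
  qed
  then obtain m where m: "m \<in> A" "\<forall>i\<in>A. (m, i) \<in> r" by auto
  have "ord_min r A = m"
    unfolding ord_min_def using m anti by (intro the_equality) auto
  then show ?thesis using m anti by auto
qed

text \<open>Finite \<open>Ssum\<close> leaves finitely many exceedances, so the minimum exists. The
  right-hand side is a countable combination of measurable conditions, which yields measurability of
  the event as well.\<close>

lemma Ife_eq_Some_iff:
  assumes "linear_order r"
  shows "Ife r f = Some j \<longleftrightarrow> Ssum f < \<top> \<and> f j > 1 \<and> (\<forall>i. f i > 1 \<longrightarrow> (j, i) \<in> r)"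
proof (cases "Ssum f < \<top> \<and> (\<exists>t. f t > 1)")
  case True
  have "finite {t. f t > 1}"
    using True by (auto intro: finite_subset[OF _ Ssum_finite_level_set[of f 1]])
  with True show ?thesis
    using ord_min_eq_iff[OF assms, of "{t. f t > 1}" j] by (auto simp: Ife_def)
qed (auto simp: Ife_def)

lemma IA_eq_Some_iff:
  assumes "linear_order r"
  shows "IA r f = Some j \<longleftrightarrow>
    Ssum f < \<top> \<and> f j > 0 \<and> (\<forall>i. f i \<le> f j) \<and> (\<forall>k. (\<forall>i. f i \<le> f k) \<longrightarrow> (j, k) \<in> r)"
proof (cases "Ssum f < \<top> \<and> (\<exists>t. f t > 0)")
  case True
  then obtain s where s: "f s > 0" by auto
  \<comment> \<open>Only finitely many entries reach the positive value \<open>f s\<close>, so the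
    supremum is attained on \<open>?L\<close> and all maximisers lie there.\<close>
  let ?A = "{j. \<forall>i. f i \<le> f j}" and ?L = "{t. f t \<ge> f s}"
  have L: "finite ?L" using Ssum_finite_level_set[OF _ s] True by auto
  then have "finite ?A" by (rule finite_subset[rotated]) auto
  moreover have "?A \<noteq> {}"
  proof -
    have "Max (f ` ?L) \<in> f ` ?L" using L by (intro Max_in) auto
    then obtain m where m: "m \<in> ?L" "f m = Max (f ` ?L)" by auto
    have "f i \<le> f m" for i
    proof (cases "i \<in> ?L")
      case True
      then show ?thesis using L m(2) by simp
    next
      case False
      then show ?thesis using m(1) by simp
    qed
    then show ?thesis by auto
  qed
  moreover have "f j > 0" if "\<forall>i. f i \<le> f j"
    using s that by (meson less_le_trans)
  ultimately show ?thesis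
    using True ord_min_eq_iff[OF assms, of ?A j] by (auto simp: IA_def)
qed (auto simp: IA_def)

lemma pred_PE_coord_le [measurable]: "Measurable.pred PE (\<lambda>f :: 'd::finite field. f i \<le> f j)"
  unfolding pred_def by (intro borel_measurable_le measurable_PE_coord)

lemma IA_event_in_sets:
  assumes "linear_order r"
  shows "{f. IA r f = Some 0} \<in> sets (PE :: 'd::finite field measure)"
  unfolding IA_eq_Some_iff[OF assms]
  by (intro Collect_in_sets_PE pred_intros_logic pred_intros_countable pred_PE_coord_le) measurable

lemma Ife_event_in_sets:
  assumes "linear_order r"
  shows "{f. Ife r f = Some 0} \<in> sets (PE :: 'd::finite field measure)"
  unfolding Ife_eq_Some_iff[OF assms] by (rule Collect_in_sets_PE) measurable

lemma IA_scale:
  assumes "linear_order r" "0 < c"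
  shows "IA r (\<lambda>t. c * f t) = IA r f"
proof -
  have "IA r (\<lambda>t. c * f t) = Some j \<longleftrightarrow> IA r f = Some j" for j
    using assms by (simp add: IA_eq_Some_iff Ssum_scale_finite_iff zero_less_mult_iff)
  then show ?thesis by (metis not_None_eq)
qed

section \<open>First exceedance and first maximum as anchors, and the case of extremal index
  one\<close>

context tail_measure
begin

text \<open>Translation invariance of \<open>r\<close> provides the equivariance, and under
  \<open>tail_law\<close> the origin itself is an exceedance, so the functional is defined whenever
  the sum is finite.\<close>

lemma first_exceedance_probability_eq_theta:
  assumes "transl_inv_total_order r"
  shows "measure tail_law {f. Ife r f = Some 0} = theta"
proof -
  have lin: "linear_order r" and inv: "\<And>i j h. (i, j) \<in> r \<Longrightarrow> (i + h, j + h) \<in> r"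
    using assms by (auto simp: transl_inv_total_order_def)
  note iff = Ife_eq_Some_iff[OF lin]
  have eq: "{f. Ife r f = Some 0} = {f. Ife r f = Some 0 \<and> Ssum f < \<top>}"
    by (auto simp: iff)
  also have "measure tail_law \<dots> = theta"
  proof (rule anchoring_probability_eq_theta)
    show "{f. Ife r f = Some 0 \<and> Ssum f < \<top>} \<in> sets PE"
      using Ife_event_in_sets[OF lin] unfolding eq .
    show "Ife r (shift i f) = Some (j + i)" if "Ife r f = Some j" for f :: "'d field" and i j
      unfolding iff
    proof (intro conjI allI impI)
      show "Ssum (shift i f) < \<top>" using that by (simp add: iff)
      show "1 < shift i f (j + i)" using that by (simp add: iff shift_def)
      fix k assume "1 < shift i f k"
      then have "(j, k - i) \<in> r" using that by (auto simp: iff shift_def)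
      from inv[OF this, of i] show "(j + i, k) \<in> r" by simp
    qed
    show "min (f 0) 1 \<le> f j" if "Ife r f = Some j" for f :: "'d field" and j
      using that by (auto simp: iff intro: min.coboundedI2)
    show "AE f in tail_law. Ssum f < \<top> \<longrightarrow> Ife r f \<noteq> None"
      using AE_tail_law_gt_1 by eventually_elim (auto simp: Ife_def)
  qed
  finally show ?thesis .
qed

lemma first_maximum_probability_eq_theta:
  assumes "transl_inv_total_order r"
  shows "measure tail_law {f. IA r f = Some 0} = theta"
proof -
  have lin: "linear_order r" and inv: "\<And>i j h. (i, j) \<in> r \<Longrightarrow> (i + h, j + h) \<in> r"
    using assms by (auto simp: transl_inv_total_order_def)
  note iff = IA_eq_Some_iff[OF lin]
  have eq: "{f. IA r f = Some 0} = {f. IA r f = Some 0 \<and> Ssum f < \<top>}"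
    by (auto simp: iff)
  also have "measure tail_law \<dots> = theta"
  proof (rule anchoring_probability_eq_theta)
    show "{f. IA r f = Some 0 \<and> Ssum f < \<top>} \<in> sets PE"
      using IA_event_in_sets[OF lin] unfolding eq .
    show "IA r (shift i f) = Some (j + i)" if *: "IA r f = Some j" for f :: "'d field" and i j
      unfolding iff
    proof (intro conjI allI impI)
      show "Ssum (shift i f) < \<top>" using * by (simp add: iff)
      show "0 < shift i f (j + i)" "shift i f k \<le> shift i f (j + i)" for k
        using * by (auto simp: iff shift_def)
      fix k assume "\<forall>l. shift i f l \<le> shift i f k"
      then have "f l \<le> f (k - i)" for l
        by (auto simp: shift_def dest!: spec[of _ "l + i"])
      then have "(j, k - i) \<in> r" using * by (auto simp: iff)
      from inv[OF this, of i] show "(j + i, k) \<in> r" by simp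
    qed
    show "min (f 0) 1 \<le> f j" if "IA r f = Some j" for f :: "'d field" and j
      using that by (auto simp: iff intro: min.coboundedI1)
    show "AE f in tail_law. Ssum f < \<top> \<longrightarrow> IA r f \<noteq> None"
      using AE_tail_law_gt_1
    proof eventually_elim
      fix f :: "'d field" assume "1 < f 0"
      then have "0 < f 0" by simp
      then show "Ssum f < \<top> \<longrightarrow> IA r f \<noteq> None" by (auto simp: IA_def)
    qed
  qed
  finally show ?thesis .
qed

text \<open>The variable 1/B is at most 1, so its mean is 1 only if B = 1 almost surely, and then
  the origin is the sole exceedance.\<close>

lemma theta_eq_1_iff: "theta = 1 \<longleftrightarrow> (AE f in tail_law. \<forall>i. i \<noteq> 0 \<longrightarrow> f i \<le> 1)"
proof -
  have "theta = 1 \<longleftrightarrow> (\<integral>f. 1 - ratio_enn 1 (Bcnt f) \<partial>tail_law) = 0"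
    using integrable_ratio_Bcnt by (simp add: theta_def tail.prob_space[simplified])
  also have "\<dots> \<longleftrightarrow> (AE f in tail_law. 1 - ratio_enn 1 (Bcnt f) = 0)"
    using integrable_ratio_Bcnt
    by (intro integral_nonneg_eq_0_iff_AE) (auto simp: ratio_enn_1_le_1)
  also have "\<dots> \<longleftrightarrow> (AE f in tail_law. \<forall>i. i \<noteq> 0 \<longrightarrow> f i \<le> 1)"
  proof -
    have "1 - ratio_enn 1 (Bcnt f) = 0 \<longleftrightarrow> (\<forall>i. i \<noteq> 0 \<longrightarrow> f i \<le> 1)" if "f 0 > 1" for f :: "'d field"
    proof -
      have "1 - ratio_enn 1 (Bcnt f) = 0 \<longleftrightarrow> card {t. f t > 1} = 1"
        by (auto simp: ratio_enn_1_Bcnt)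
      also have "\<dots> \<longleftrightarrow> {t. f t > 1} = {0}"
      proof
        assume "card {t. f t > 1} = 1"
        then obtain s where s: "{t. f t > 1} = {s}" by (rule card_1_singletonE)
        have "0 \<in> {t. f t > 1}" using that by simp
        then show "{t. f t > 1} = {0}" unfolding s by simp
      qed simp
      also have "\<dots> \<longleftrightarrow> (\<forall>i. i \<noteq> 0 \<longrightarrow> f i \<le> 1)"
        using that by (auto simp: not_less[symmetric])
      finally show ?thesis .
    qed
    then show ?thesis
      by (intro eventually_subst eventually_mono[OF AE_tail_law_gt_1])
  qed
  finally show ?thesis .
qed

end

section \<open>The spectral tail field\<close>

locale max_stable_tail = max_stable_spectral M X Z for M :: "'a measure" and X Z :: "'a \<Rightarrow> 'd::finite field" +
  fixes Th :: "'a \<Rightarrow> 'd field" and R :: "'a \<Rightarrow> real"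
  assumes spectral_tail: "spectral_tail M Z Th" and unit_pareto: "unit_pareto M R"
    and indep: "\<And>A B. A \<in> sets borel \<Longrightarrow> B \<in> sets PE \<Longrightarrow>
      measure M {\<omega>\<in>space M. R \<omega> \<in> A \<and> Th \<omega> \<in> B}
        = measure M {\<omega>\<in>space M. R \<omega> \<in> A} * measure M {\<omega>\<in>space M. Th \<omega> \<in> B}"
begin

lemma measurable_Th [measurable]: "Th \<in> measurable M PE"
  using spectral_tail by (simp add: spectral_tail_def)

lemma measurable_Th_coord [measurable]: "(\<lambda>\<omega>. Th \<omega> t) \<in> borel_measurable M"
  by (rule measurable_field_coord[OF measurable_Th])

lemma measurable_R [measurable]: "R \<in> borel_measurable M"
  using unit_pareto by (simp add: unit_pareto_def)

lemma measurable_normalized_Z: "(\<lambda>\<omega> t. Z \<omega> t / Z \<omega> 0) \<in> measurable M PE"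
  by (rule measurable_into_PE) measurable

text \<open>The spectral tail field is \<open>Z\<close> normalised at the origin under the law
  tilted by Z(0). Where Z(0) = 0 the division is a default value, to which the tilt gives no
  weight.\<close>

lemma distr_Th:
  "distr M PE Th = distr (density M (\<lambda>\<omega>. ennreal (Z \<omega> 0))) PE (\<lambda>\<omega> t. Z \<omega> t / Z \<omega> 0)"
proof (rule measure_eqI)
  fix A assume "A \<in> sets (distr M PE Th)"
  then have A [measurable]: "A \<in> sets PE" by simp
  note [measurable] = measurable_normalized_Z
  have "emeasure (distr M PE Th) A = ennreal (measure M {\<omega>\<in>space M. Th \<omega> \<in> A})"
    by (auto simp: emeasure_distr emeasure_eq_measure intro!: arg_cong[where f = "measure M"])
  also have "\<dots> = ennreal (\<integral>\<omega>. Z \<omega> 0 * indicator A (\<lambda>t. Z \<omega> t / Z \<omega> 0) \<partial>M)"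
    using spectral_tail by (simp add: spectral_tail_def)
  also have "\<dots> = (\<integral>\<^sup>+\<omega>. ennreal (Z \<omega> 0 * indicator A (\<lambda>t. Z \<omega> t / Z \<omega> 0)) \<partial>M)"
  proof (rule nn_integral_eq_integral[symmetric])
    show "integrable M (\<lambda>\<omega>. Z \<omega> 0 * indicator A (\<lambda>t. Z \<omega> t / Z \<omega> 0))"
      by (rule Bochner_Integration.integrable_bound[OF integrable_Z[of 0]]) (auto simp: indicator_def)
  qed (auto simp: Z_nonneg)
  also have "\<dots> = (\<integral>\<^sup>+\<omega>. ennreal (Z \<omega> 0) * indicator ((\<lambda>\<omega> t. Z \<omega> t / Z \<omega> 0) -` A \<inter> space M) \<omega> \<partial>M)"
    by (intro nn_integral_cong) (auto simp: indicator_def)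
  also have "\<dots> = emeasure (density M (\<lambda>\<omega>. ennreal (Z \<omega> 0))) ((\<lambda>\<omega> t. Z \<omega> t / Z \<omega> 0) -` A \<inter> space M)"
    by (rule emeasure_density[symmetric]) measurable
  also have "\<dots> = emeasure (distr (density M (\<lambda>\<omega>. ennreal (Z \<omega> 0))) PE (\<lambda>\<omega> t. Z \<omega> t / Z \<omega> 0)) A"
    by (simp add: emeasure_distr)
  finally show "emeasure (distr M PE Th) A
      = emeasure (distr (density M (\<lambda>\<omega>. ennreal (Z \<omega> 0))) PE (\<lambda>\<omega> t. Z \<omega> t / Z \<omega> 0)) A" .
qed simp

lemma nn_integral_Th:
  assumes [measurable]: "G \<in> borel_measurable PE"
  shows "(\<integral>\<^sup>+f. G f \<partial>distr M PE Th) = (\<integral>\<^sup>+\<omega>. ennreal (Z \<omega> 0) * G (\<lambda>t. Z \<omega> t / Z \<omega> 0) \<partial>M)"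
proof -
  note [measurable] = measurable_normalized_Z
  show ?thesis
    unfolding distr_Th by (simp add: nn_integral_distr nn_integral_density)
qed

lemma AE_Th_nonneg: "AE \<omega> in M. \<forall>t. 0 \<le> Th \<omega> t"
proof -
  have N: "{f::'d field. \<not> (\<forall>t. 0 \<le> f t)} \<in> sets PE"
    by (rule Collect_in_sets_PE) measurable
  have "emeasure (distr M PE Th) {f. \<not> (\<forall>t. 0 \<le> f t)}
      = (\<integral>\<^sup>+f. indicator {f. \<not> (\<forall>t. 0 \<le> f t)} f \<partial>distr M PE Th)"
    using N by simp
  also have "\<dots> = (\<integral>\<^sup>+\<omega>. ennreal (Z \<omega> 0) * indicator {f. \<not> (\<forall>t. 0 \<le> f t)} (\<lambda>t. Z \<omega> t / Z \<omega> 0) \<partial>M)"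
    using N by (intro nn_integral_Th) measurable
  also have "\<dots> = (\<integral>\<^sup>+\<omega>. 0 \<partial>M)"
    by (intro nn_integral_cong) (auto simp: indicator_def Z_nonneg)
  finally have "AE f in distr M PE Th. \<forall>t. 0 \<le> f t"
    using N by (intro AE_I[of _ _ "{f. \<not> (\<forall>t. 0 \<le> f t)}"]) auto
  then show ?thesis by (intro AE_distrD[of Th M PE]) auto
qed

lemma AE_R_gt_1: "AE \<omega> in M. 1 < R \<omega>"
proof -
  have "prob {\<omega>\<in>space M. R \<omega> > 1} = 1"
    using unit_pareto by (simp add: unit_pareto_def)
  then show ?thesis by (subst (asm) prob_Collect_eq_1) auto
qed

text \<open>The product formula on rectangles determines the joint law, which makes Tonelli
  available for \<open>R\<close> and \<open>Th\<close>.\<close>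

lemma distr_Th_R: "distr M PE Th \<Otimes>\<^sub>M distr M borel R = distr M (PE \<Otimes>\<^sub>M borel) (\<lambda>\<omega>. (Th \<omega>, R \<omega>))"
proof (rule pair_measure_eqI)
  show "sigma_finite_measure (distr M PE Th)" "sigma_finite_measure (distr M borel R)"
    by (auto intro!: prob_space_imp_sigma_finite prob_space_distr)
  fix A B assume "A \<in> sets (distr M PE Th)" "B \<in> sets (distr M borel R)"
  then have AB [measurable]: "A \<in> sets PE" "B \<in> sets borel" by auto
  have "emeasure (distr M PE Th) A * emeasure (distr M borel R) B
      = ennreal (measure M {\<omega>\<in>space M. Th \<omega> \<in> A}) * ennreal (measure M {\<omega>\<in>space M. R \<omega> \<in> B})"
    by (auto simp: emeasure_distr emeasure_eq_measure
        intro!: arg_cong2[where f = "(*)"] arg_cong[where f = "\<lambda>A. ennreal (measure M A)"])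
  also have "\<dots> = ennreal (measure M {\<omega>\<in>space M. R \<omega> \<in> B \<and> Th \<omega> \<in> A})"
    by (simp add: indep ennreal_mult mult.commute)
  also have "\<dots> = emeasure (distr M (PE \<Otimes>\<^sub>M borel) (\<lambda>\<omega>. (Th \<omega>, R \<omega>))) (A \<times> B)"
    by (auto simp: emeasure_distr emeasure_eq_measure intro!: arg_cong[where f = "measure M"])
  finally show "emeasure (distr M PE Th) A * emeasure (distr M borel R) B
      = emeasure (distr M (PE \<Otimes>\<^sub>M borel) (\<lambda>\<omega>. (Th \<omega>, R \<omega>))) (A \<times> B)" .
qed (auto intro!: sets_pair_measure_cong)

section \<open>The law of the tail field\<close>

definition Y :: "'a \<Rightarrow> 'd field" where
  "Y \<omega> = (\<lambda>t. R \<omega> * Th \<omega> t)"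

lemma measurable_Y [measurable]: "Y \<in> measurable M PE"
  unfolding Y_def by (rule measurable_into_PE) measurable

text \<open>The tilt Z(0) is exactly the factor produced by the substitution of z/Z(0) for z in the
  Pareto intensity. It turns R Z/Z(0) with R > 1 into z Z with z Z(0) > 1, which is the exponent
  measure restricted to an exceedance at the origin.\<close>

lemma nn_integral_Y:
  assumes F [measurable]: "F \<in> borel_measurable PE"
  shows "(\<integral>\<^sup>+\<omega>. F (Y \<omega>) \<partial>M) = (\<integral>\<^sup>+f. F f \<partial>tail_law)"
proof -
  have scale: "(\<lambda>p t. snd p * fst p t) \<in> measurable (PE \<Otimes>\<^sub>M borel) (PE :: 'd field measure)"
    by (rule measurable_into_PE) (auto intro!: borel_measurable_times measurable_snd measurable_field_coord[OF measurable_fst])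
  have F_scale [measurable]: "(\<lambda>p. F (\<lambda>t. snd p * fst p t)) \<in> borel_measurable (PE \<Otimes>\<^sub>M borel)"
    by (rule measurable_compose[OF scale F])
  have F_line [measurable]: "(\<lambda>z. F (\<lambda>t. z * f t)) \<in> borel_measurable borel" for f
    by (rule measurable_compose[OF measurable_scale_field F])
  interpret distr_R: prob_space "distr M borel R"
    by (rule prob_space_distr) measurable
  define H where "H f = (\<integral>\<^sup>+z. F (\<lambda>t. z * f t) \<partial>distr M borel R)" for f
  have H_meas [measurable]: "H \<in> borel_measurable PE"
  proof -
    have "(\<lambda>f. \<integral>\<^sup>+z. (\<lambda>p. F (\<lambda>t. snd p * fst p t)) (f, z) \<partial>distr M borel R) \<in> borel_measurable PE"
      by (rule distr_R.borel_measurable_nn_integral_fst)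
         (simp add: F_scale cong: measurable_cong_sets sets_pair_measure_cong)
    then show ?thesis by (simp add: H_def[abs_def])
  qed
  have H_eq: "H f = (\<integral>\<^sup>+z. indicator {1<..} z * F (\<lambda>t. z * f t) \<partial>pareto_intensity)" for f
    unfolding H_def unit_pareto_distr[OF prob_space_axioms unit_pareto]
    by (rule nn_integral_density) measurable
  have "(\<integral>\<^sup>+\<omega>. F (Y \<omega>) \<partial>M) = (\<integral>\<^sup>+p. F (\<lambda>t. snd p * fst p t) \<partial>distr M (PE \<Otimes>\<^sub>M borel) (\<lambda>\<omega>. (Th \<omega>, R \<omega>)))"
    by (subst nn_integral_distr) (simp_all add: Y_def)
  also have "\<dots> = (\<integral>\<^sup>+p. F (\<lambda>t. snd p * fst p t) \<partial>(distr M PE Th \<Otimes>\<^sub>M distr M borel R))"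
    by (simp only: distr_Th_R)
  also have "\<dots> = (\<integral>\<^sup>+f. H f \<partial>distr M PE Th)"
    unfolding H_def
    by (subst distr_R.nn_integral_fst[symmetric])
       (simp_all add: F_scale cong: measurable_cong_sets sets_pair_measure_cong)
  also have "\<dots> = (\<integral>\<^sup>+\<omega>. ennreal (Z \<omega> 0) * H (\<lambda>t. Z \<omega> t / Z \<omega> 0) \<partial>M)"
    by (rule nn_integral_Th) measurable
  also have "\<dots> = (\<integral>\<^sup>+\<omega>. \<integral>\<^sup>+z. indicator {1<..} (z * Z \<omega> 0) * F (\<lambda>t. z * Z \<omega> t) \<partial>pareto_intensity \<partial>M)"
  proof (rule nn_integral_cong)
    fix \<omega> assume \<omega>: "\<omega> \<in> space M"
    show "ennreal (Z \<omega> 0) * H (\<lambda>t. Z \<omega> t / Z \<omega> 0)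
        = (\<integral>\<^sup>+z. indicator {1<..} (z * Z \<omega> 0) * F (\<lambda>t. z * Z \<omega> t) \<partial>pareto_intensity)"
    proof (cases "Z \<omega> 0 = 0")
      case False
      with Z_nonneg[OF \<omega>, of 0] have pos: "0 < Z \<omega> 0" by simp
      show ?thesis
        using nn_integral_pareto_intensity_scale[of "\<lambda>z. indicator {1<..} (z * Z \<omega> 0) * F (\<lambda>t. z * Z \<omega> t)", OF _ pos] pos
        by (simp add: H_eq)
    qed simp
  qed
  also have "\<dots> = (\<integral>\<^sup>+f. indicator {1<..} (f 0) * F f \<partial>\<nu>)"
    unfolding \<nu>_def by (rule nn_integral_exponent_measure[symmetric, OF measurable_Z]) measurable
  also have "\<dots> = (\<integral>\<^sup>+f. F f \<partial>tail_law)"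
    by (rule nn_integral_tail_law[symmetric]) measurable
  finally show ?thesis .
qed

lemma distr_Y: "distr M PE Y = tail_law"
proof (rule measure_eqI)
  fix A assume "A \<in> sets (distr M PE Y)"
  then have [measurable]: "A \<in> sets PE" by simp
  have "emeasure (distr M PE Y) A = (\<integral>\<^sup>+f. indicator A f \<partial>distr M PE Y)" by simp
  also have "\<dots> = (\<integral>\<^sup>+\<omega>. indicator A (Y \<omega>) \<partial>M)" by (rule nn_integral_distr) measurable
  also have "\<dots> = (\<integral>\<^sup>+f. indicator A f \<partial>tail_law)" by (rule nn_integral_Y) measurable
  also have "\<dots> = emeasure tail_law A" by simp
  finally show "emeasure (distr M PE Y) A = emeasure tail_law A" .
qed simp

lemma measure_Y:
  assumes "{f. Q f} \<in> sets PE"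
  shows "measure M {\<omega>\<in>space M. Q (Y \<omega>)} = measure tail_law {f. Q f}"
  unfolding distr_Y[symmetric] using assms
  by (subst measure_distr) (auto intro!: arg_cong[where f = "measure M"])

lemma AE_Y: "AE f in tail_law. Q f \<Longrightarrow> AE \<omega> in M. Q (Y \<omega>)"
  unfolding distr_Y[symmetric] by (rule AE_distrD[OF measurable_Y])

section \<open>The expressions of the theorem in terms of \<open>Y\<close> and
  \<open>Th\<close>\<close>

lemma expectation_inverse_Bcnt: "(\<integral>\<omega>. ratio_enn 1 (Bcnt (Y \<omega>)) \<partial>M) = theta"
  unfolding theta_def distr_Y[symmetric] by (rule integral_distr[symmetric]) measurable

text \<open>The ratio is invariant under scaling by 1/Z(0), so the tilted expectation is the one
  already computed for \<open>Z\<close>; where Z(0) = 0 both integrands vanish.\<close>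

lemma expectation_Th_ratio: "(\<integral>\<omega>. ratio_enn (Mx (Th \<omega>)) (Ssum (Th \<omega>)) \<partial>M) = theta"
proof -
  have "(\<integral>\<^sup>+\<omega>. ennreal (ratio_enn (Mx (Th \<omega>)) (Ssum (Th \<omega>))) \<partial>M)
      = (\<integral>\<^sup>+f. ennreal (ratio_enn (Mx f) (Ssum f)) \<partial>distr M PE Th)"
    by (rule nn_integral_distr[symmetric]) measurable
  also have "\<dots> = (\<integral>\<^sup>+\<omega>. ennreal (Z \<omega> 0) * ennreal (ratio_enn (Mx (\<lambda>t. Z \<omega> t / Z \<omega> 0)) (Ssum (\<lambda>t. Z \<omega> t / Z \<omega> 0))) \<partial>M)"
    by (rule nn_integral_Th) measurable
  also have "\<dots> = (\<integral>\<^sup>+\<omega>. ennreal (Z \<omega> 0 * ratio_enn (Mx (Z \<omega>)) (Ssum (Z \<omega>))) \<partial>M)"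
  proof (rule nn_integral_cong)
    fix \<omega> assume \<omega>: "\<omega> \<in> space M"
    show "ennreal (Z \<omega> 0) * ennreal (ratio_enn (Mx (\<lambda>t. Z \<omega> t / Z \<omega> 0)) (Ssum (\<lambda>t. Z \<omega> t / Z \<omega> 0)))
        = ennreal (Z \<omega> 0 * ratio_enn (Mx (Z \<omega>)) (Ssum (Z \<omega>)))"
    proof (cases "Z \<omega> 0 = 0")
      case False
      then have pos: "0 < 1 / Z \<omega> 0" using Z_nonneg[OF \<omega>, of 0] by simp
      have "ratio_enn (Mx (\<lambda>t. 1 / Z \<omega> 0 * Z \<omega> t)) (Ssum (\<lambda>t. 1 / Z \<omega> 0 * Z \<omega> t)) = ratio_enn (Mx (Z \<omega>)) (Ssum (Z \<omega>))"
        using pos by (simp only: Mx_scale Ssum_scale less_imp_le ratio_enn_scale)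
      then show ?thesis
        using Z_nonneg[OF \<omega>, of 0] by (simp add: ennreal_mult ratio_enn_nonneg)
    qed simp
  qed
  also have "\<dots> = ennreal theta" by (rule nn_integral_Z_ratio)
  finally have "(\<integral>\<^sup>+\<omega>. ennreal (ratio_enn (Mx (Th \<omega>)) (Ssum (Th \<omega>))) \<partial>M) = ennreal theta" .
  then show ?thesis
    by (subst integral_eq_nn_integral) (auto simp: ratio_enn_nonneg theta_nonneg)
qed

lemma AE_Ssum_Th_iff: "AE \<omega> in M. Ssum (Th \<omega>) < \<top> \<longleftrightarrow> Ssum (Y \<omega>) < \<top>"
  using AE_R_gt_1 by eventually_elim (simp add: Y_def Ssum_scale_finite_iff)

text \<open>\<open>R\<close> is unbounded and independent of \<open>Th\<close>: if \<open>Th\<close>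
  at \<open>i\<close> exceeded 1/s with positive probability, then \<open>R\<close> > s would occur
  simultaneously and create a second exceedance of \<open>Y\<close>.\<close>

lemma theta_eq_1_iff_Th: "theta = 1 \<longleftrightarrow> (\<forall>i. i \<noteq> 0 \<longrightarrow> (AE \<omega> in M. Th \<omega> i = 0))"
proof
  assume "theta = 1"
  then have le: "AE \<omega> in M. \<forall>i. i \<noteq> 0 \<longrightarrow> Y \<omega> i \<le> 1"
    unfolding theta_eq_1_iff by (rule AE_Y)
  show "\<forall>i. i \<noteq> 0 \<longrightarrow> (AE \<omega> in M. Th \<omega> i = 0)"
  proof (intro allI impI)
    fix i :: "int ^ 'd" assume i: "i \<noteq> 0"
    have "AE \<omega> in M. Th \<omega> i \<le> 1 / real (Suc n)" for n
    proof -
      let ?s = "real (Suc n)"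
      let ?B = "{f :: 'd field. 1 / ?s < f i}"
      have B: "?B \<in> sets PE" by (rule Collect_in_sets_PE) measurable
      have "AE \<omega> in M. \<not> (R \<omega> \<in> {?s<..} \<and> Th \<omega> \<in> ?B)"
        using le
      proof eventually_elim
        fix \<omega> assume *: "\<forall>i. i \<noteq> 0 \<longrightarrow> Y \<omega> i \<le> 1"
        show "\<not> (R \<omega> \<in> {?s<..} \<and> Th \<omega> \<in> ?B)"
        proof
          assume "R \<omega> \<in> {?s<..} \<and> Th \<omega> \<in> ?B"
          then have "?s * (1 / ?s) < R \<omega> * Th \<omega> i"
            by (intro mult_strict_mono) (auto simp del: of_nat_Suc)
          with * i show False by (auto simp: Y_def)
        qed
      qed
      then have "measure M {\<omega>\<in>space M. R \<omega> \<in> {?s<..} \<and> Th \<omega> \<in> ?B} = 0"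
        using emeasure_eq_0_AE[of "\<lambda>\<omega>. R \<omega> \<in> {?s<..} \<and> Th \<omega> \<in> ?B" M] by (simp only: measure_def enn2real_0)
      moreover have "measure M {\<omega>\<in>space M. R \<omega> \<in> {?s<..}} = 1 / ?s"
        using unit_pareto by (simp add: unit_pareto_def)
      \<comment> \<open>The product of the two probabilities is zero while the factor for
        \<open>R\<close> equals 1/s > 0.\<close>
      ultimately have "measure M {\<omega>\<in>space M. Th \<omega> \<in> ?B} = 0"
        using indep[of "{?s<..}" ?B] B by (simp del: of_nat_Suc)
      then have "AE \<omega> in M. \<not> 1 / ?s < Th \<omega> i"
        by (subst (asm) prob_Collect_eq_0) (auto simp del: of_nat_Suc)
      then show ?thesis by (simp only: not_less)
    qed
    then have "AE \<omega> in M. \<forall>n. Th \<omega> i \<le> 1 / real (Suc n)"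
      by (subst AE_all_countable) blast
    with AE_Th_nonneg show "AE \<omega> in M. Th \<omega> i = 0"
    proof eventually_elim
      fix \<omega> assume nn: "\<forall>t. 0 \<le> Th \<omega> t" and small: "\<forall>n. Th \<omega> i \<le> 1 / real (Suc n)"
      have "\<not> 0 < Th \<omega> i"
      proof
        assume "0 < Th \<omega> i"
        then obtain n where "1 / real (Suc n) < Th \<omega> i" by (rule nat_approx_posE)
        with small show False by (simp add: not_less[symmetric] del: of_nat_Suc)
      qed
      with nn show "Th \<omega> i = 0" by (simp add: order.antisym not_less)
    qed
  qed
next
  assume "\<forall>i. i \<noteq> 0 \<longrightarrow> (AE \<omega> in M. Th \<omega> i = 0)"
  then have "AE \<omega> in M. \<forall>i. i \<noteq> 0 \<longrightarrow> Th \<omega> i = 0"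
    by (subst AE_all_countable) auto
  then have "AE \<omega> in M. \<forall>i. i \<noteq> 0 \<longrightarrow> Y \<omega> i \<le> 1"
    by eventually_elim (simp add: Y_def)
  moreover have "{f :: 'd field. \<forall>i. i \<noteq> 0 \<longrightarrow> f i \<le> 1} \<in> sets PE"
    by (rule Collect_in_sets_PE) measurable
  ultimately show "theta = 1"
    unfolding theta_eq_1_iff distr_Y[symmetric] by (subst AE_distr_iff) auto
qed

lemma anchoring_map_probability:
  assumes I: "anchoring_map I"
    and fin: "measure M {\<omega>\<in>space M. I (Y \<omega>) \<noteq> None \<and> Ssum (Y \<omega>) < \<top>}
           = measure M {\<omega>\<in>space M. Ssum (Y \<omega>) < \<top>}"
  shows "measure M {\<omega>\<in>space M. I (Y \<omega>) = Some 0 \<and> Ssum (Y \<omega>) < \<top>} = theta"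
proof -
  have I_meas [measurable]: "I \<in> measurable PE (count_space UNIV)"
    using I by (simp add: anchoring_map_def)
  have S: "{f. Ssum f < \<top>} \<in> sets (PE :: 'd field measure)"
    by (rule Collect_in_sets_PE) measurable
  have anchor_in_sets: "{f. I f \<in> J \<and> Ssum f < \<top>} \<in> sets PE" for J
  proof -
    have "{f. I f \<in> J \<and> Ssum f < \<top>} = (I -` J \<inter> space PE) \<inter> {f. Ssum f < \<top>}" by auto
    then show ?thesis using S by (auto intro!: sets.Int measurable_sets[OF I_meas])
  qed
  have sets: "{f. I f = Some 0 \<and> Ssum f < \<top>} \<in> sets PE" "{f. I f \<noteq> None \<and> Ssum f < \<top>} \<in> sets PE"
    using anchor_in_sets[of "{Some 0}"] anchor_in_sets[of "- {None}"] by simp_all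
  \<comment> \<open>Equal probabilities of nested events leave a null difference, which is the
    almost sure form required for orbits.\<close>
  have "measure tail_law ({f. Ssum f < \<top>} - {f. I f \<noteq> None \<and> Ssum f < \<top>})
      = measure tail_law {f. Ssum f < \<top>} - measure tail_law {f. I f \<noteq> None \<and> Ssum f < \<top>}"
    using sets(2) S by (intro tail.finite_measure_Diff) auto
  also have "\<dots> = 0"
    using fin measure_Y[OF sets(2)] measure_Y[OF S] by simp
  finally have "AE f in tail_law. f \<notin> {f. Ssum f < \<top>} - {f. I f \<noteq> None \<and> Ssum f < \<top>}"
    using sets(2) S by (subst (asm) tail.prob_eq_0) auto
  then have "AE f in tail_law. Ssum f < \<top> \<longrightarrow> I f \<noteq> None"
    by eventually_elim auto
  then have "measure tail_law {f. I f = Some 0 \<and> Ssum f < \<top>} = theta"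
    using I by (intro anchoring_probability_eq_theta sets(1)) (auto simp: anchoring_map_def)
  then show ?thesis
    by (simp add: measure_Y[OF sets(1)])
qed

text \<open>Almost surely \<open>R\<close> is positive and \<open>Th\<close> nonnegative, so passing
  from \<open>Th\<close> to \<open>Y\<close> changes neither the anchor nor the finiteness of the
  sum.\<close>

lemma homogeneous_anchoring_map_probability:
  assumes I: "anchoring_map I" and hom: "zero_homogeneous I"
  shows "measure M {\<omega>\<in>space M. I (Th \<omega>) = Some 0 \<and> Ssum (Th \<omega>) < \<top>}
    = measure M {\<omega>\<in>space M. I (Y \<omega>) = Some 0 \<and> Ssum (Y \<omega>) < \<top>}"
proof (rule measure_eq_AE)
  have I_meas [measurable]: "I \<in> measurable PE (count_space UNIV)"
    using I by (simp add: anchoring_map_def)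
  show "{\<omega>\<in>space M. I (Th \<omega>) = Some 0 \<and> Ssum (Th \<omega>) < \<top>} \<in> sets M"
    "{\<omega>\<in>space M. I (Y \<omega>) = Some 0 \<and> Ssum (Y \<omega>) < \<top>} \<in> sets M"
    by measurable
  show "AE \<omega> in M. \<omega> \<in> {\<omega>\<in>space M. I (Th \<omega>) = Some 0 \<and> Ssum (Th \<omega>) < \<top>}
      \<longleftrightarrow> \<omega> \<in> {\<omega>\<in>space M. I (Y \<omega>) = Some 0 \<and> Ssum (Y \<omega>) < \<top>}"
    using AE_Ssum_Th_iff AE_Th_nonneg AE_R_gt_1
    by eventually_elim (use hom in \<open>auto simp: zero_homogeneous_def Y_def\<close>)
qed

lemma first_maximum_probability:
  assumes r: "transl_inv_total_order r"
  shows "measure M {\<omega>\<in>space M. IA r (Th \<omega>) = Some 0} = theta"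
proof -
  have lin: "linear_order r" using r by (simp add: transl_inv_total_order_def)
  note event = IA_event_in_sets[OF lin]
  have "measure M {\<omega>\<in>space M. IA r (Th \<omega>) = Some 0} = measure M {\<omega>\<in>space M. IA r (Y \<omega>) = Some 0}"
  proof (rule measure_eq_AE)
    show "AE \<omega> in M. \<omega> \<in> {\<omega>\<in>space M. IA r (Th \<omega>) = Some 0} \<longleftrightarrow> \<omega> \<in> {\<omega>\<in>space M. IA r (Y \<omega>) = Some 0}"
      using AE_R_gt_1 by eventually_elim (simp add: Y_def IA_scale[OF lin])
    have "{\<omega>\<in>space M. IA r (V \<omega>) = Some 0} = V -` {f. IA r f = Some 0} \<inter> space M" for V
      by auto
    then show "{\<omega>\<in>space M. IA r (Th \<omega>) = Some 0} \<in> sets M" "{\<omega>\<in>space M. IA r (Y \<omega>) = Some 0} \<in> sets M"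
      by (simp_all only: measurable_sets[OF measurable_Th event] measurable_sets[OF measurable_Y event])
  qed
  also have "\<dots> = theta"
    by (simp only: measure_Y[OF event] first_maximum_probability_eq_theta[OF r])
  finally show ?thesis .
qed

lemma first_exceedance_probability:
  assumes r: "transl_inv_total_order r"
  shows "measure M {\<omega>\<in>space M. Ife r (Y \<omega>) = Some 0} = theta"
proof -
  have lin: "linear_order r" using r by (simp add: transl_inv_total_order_def)
  show ?thesis
    by (simp only: measure_Y[OF Ife_event_in_sets[OF lin]] first_exceedance_probability_eq_theta[OF r])
qed

end

theorem theorem3p4:
  fixes M :: "'a measure"
    and X Z Th Y :: "'a \<Rightarrow> int ^ 'd::finite \<Rightarrow> real"
    and R :: "'a \<Rightarrow> real"
    and r :: "((int ^ 'd) \<times> (int ^ 'd)) set"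
    and I :: "(int ^ 'd \<Rightarrow> real) \<Rightarrow> (int ^ 'd) option"
  assumes "prob_space M"
    and "stationary M X"
    and "spectral_rf M X Z"
    and "spectral_tail M Z Th"
    and "unit_pareto M R"
    and "\<forall>A\<in>sets borel. \<forall>B\<in>sets PE.
           measure M {\<omega>\<in>space M. R \<omega> \<in> A \<and> Th \<omega> \<in> B}
             = measure M {\<omega>\<in>space M. R \<omega> \<in> A} * measure M {\<omega>\<in>space M. Th \<omega> \<in> B}"
    and "Y = (\<lambda>\<omega> t. R \<omega> * Th \<omega> t)"
    and "transl_inv_total_order r"
    and "anchoring_map I"
    and "measure M {\<omega>\<in>space M. I (Y \<omega>) \<noteq> None \<and> Ssum (Y \<omega>) < \<top>}
           = measure M {\<omega>\<in>space M. Ssum (Y \<omega>) < \<top>}"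
  shows "(measure M {\<omega>\<in>space M. Ssum (Th \<omega>) < \<top>} > 0 \<longrightarrow>
           ext_seq M Z \<longlonglongrightarrow> measure M {\<omega>\<in>space M. I (Y \<omega>) = Some 0 \<and> Ssum (Y \<omega>) < \<top>}
         \<and> measure M {\<omega>\<in>space M. I (Y \<omega>) = Some 0 \<and> Ssum (Y \<omega>) < \<top>}
             = measure M {\<omega>\<in>space M. Ife r (Y \<omega>) = Some 0}
         \<and> measure M {\<omega>\<in>space M. Ife r (Y \<omega>) = Some 0}
             = measure M {\<omega>\<in>space M. IA r (Th \<omega>) = Some 0}
         \<and> measure M {\<omega>\<in>space M. IA r (Th \<omega>) = Some 0}
             = (\<integral>\<omega>. ratio_enn (Mx (Th \<omega>)) (Ssum (Th \<omega>)) \<partial>M)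
         \<and> (\<integral>\<omega>. ratio_enn (Mx (Th \<omega>)) (Ssum (Th \<omega>)) \<partial>M)
             = (\<integral>\<omega>. Z \<omega> 0 * ratio_enn (Mx (Z \<omega>)) (Ssum (Z \<omega>)) \<partial>M)
         \<and> (\<integral>\<omega>. Z \<omega> 0 * ratio_enn (Mx (Z \<omega>)) (Ssum (Z \<omega>)) \<partial>M)
             = (\<integral>\<omega>. ratio_enn 1 (Bcnt (Y \<omega>)) \<partial>M)
         \<and> (zero_homogeneous I \<longrightarrow>
              ext_seq M Z \<longlonglongrightarrow> measure M {\<omega>\<in>space M. I (Th \<omega>) = Some 0 \<and> Ssum (Th \<omega>) < \<top>})
         \<and> (AE \<omega> in M. Bcnt (Y \<omega>) < \<top> \<longleftrightarrow> Ssum (Y \<omega>) < \<top>)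
         \<and> (ext_seq M Z \<longlonglongrightarrow> 1 \<longleftrightarrow> (\<forall>i. i \<noteq> 0 \<longrightarrow> (AE \<omega> in M. Th \<omega> i = 0))))
       \<and> ext_seq M Z \<longlonglongrightarrow> (\<integral>\<omega>. ratio_enn 1 (Bcnt (Y \<omega>)) \<partial>M)"
proof -
  interpret prob_space M by fact
  interpret max_stable_tail M X Z Th R
    using assms(2-6) by unfold_locales auto
  have Y: "Y = max_stable_tail.Y Th R"
    unfolding assms(7) by (simp add: fun_eq_iff Y_def)
  \<comment> \<open>The extremal index appears in the statement as a limit; uniqueness of limits
    reduces the last equivalence to \<open>theta\<close>.\<close>
  have limit_iff: "ext_seq M Z \<longlonglongrightarrow> 1 \<longleftrightarrow> theta = 1"
    using ext_seq_tendsto LIMSEQ_unique by metis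
  note anchor = anchoring_map_probability[OF assms(9) assms(10)[unfolded Y]]
  show ?thesis
    unfolding Y limit_iff theta_eq_1_iff_Th anchor expectation_Th_ratio expectation_Z_ratio
      expectation_inverse_Bcnt first_maximum_probability[OF assms(8)] first_exceedance_probability[OF assms(8)]
    using ext_seq_tendsto AE_Y[OF AE_Bcnt_finite_iff_Ssum_finite]
      homogeneous_anchoring_map_probability[OF assms(9)] anchor
    by presburger
qed

end
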